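(* Let $A,B\in\mathscr{B}(Y)$ with $[A,B]:=AB-BA=0$, let $1<\alpha\le 2$, $0<\beta\le 1$, $\eta,\hat\eta\in Y$, and let $g:\mathbb{J}\to Y$ be continuous. A mild solution $x(\cdot)\in\mathbb{C}^2(\mathbb{J},Y)$ of the Cauchy problem $$\left({}^{C}D^{\alpha}_{0+}x\right)(t)-A\left({}^{C}D^{\beta}_{0+}x\right)(t)=Bx(t)+g(t),\quad t>0,\qquad x(0)=\eta,\quad x'(0)=\hat\eta,$$ can be expressed, for $t>0$, as $$\begin{aligned}x(t)&=\Big(I+\sum_{k=0}^{\infty}\sum_{m=0}^{\infty}\binom{k+m}{m}A^kB^{m+1}\frac{t^{k(\alpha-\beta)+m\alpha+\alpha}}{\Gamma(k(\alpha-\beta)+m\alpha+\alpha+1)}\Big)\eta\\&\quad+\sum_{k=0}^{\infty}\sum_{m=0}^{\infty}\binom{k+m}{m}A^kB^m\frac{t^{k(\alpha-\beta)+m\alpha+1}}{\Gamma(k(\alpha-\beta)+m\alpha+2)}\hat\eta\\&\quad+\int_0^t\sum_{k=0}^{\infty}\sum_{m=0}^{\infty}\binom{k+m}{m}A^kB^m\frac{(t-s)^{k(\alpha-\beta)+m\alpha+\alpha-1}}{\Gamma(k(\alpha-\beta)+m\alpha+\alpha)}g(s)\,ds.\end{aligned}$$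
   Context: $Y$ is a Banach space, $\mathscr{B}(Y)$ the bounded linear operators on $Y$, $I$ the identity, $\mathbb{J}=[0,T]$; $\mathbb{C}^2(\mathbb{J},Y)$ is the space of twice continuously differentiable functions $\mathbb{J}\to Y$. For $n-1<\nu\le n$, $n\in\mathbb{N}$, the Caputo derivative is $({}^{C}D^{\nu}_{0+}x)(t)=\frac{1}{\Gamma(n-\nu)}\int_0^t(t-s)^{n-\nu-1}x^{(n)}(s)\,ds$ (Bochner integral), understood as $x^{(n)}(t)$ when $\nu=n$. A mild solution in $\mathbb{C}^2(\mathbb{J},Y)$ of the Cauchy problem is a function $x\in \mathbb{C}^2(\mathbb{J},Y)$ satisfying the equation for $t>0$, $t\in\mathbb{J}$, and the two initial conditions. *)

theory Defs
  imports "HOL-Analysis.Analysis"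
begin

text \<open>
  The constant \<open>has_bochner_integral\<close> of HOL-Analysis is restricted to second countable
  (that is, separable) target spaces. The predicate below has the same introduction rule without
  this restriction, so that it applies to arbitrary Banach spaces. Approximability by simple
  functions makes the integrand essentially separably valued, so on a complete measure this is
  the usual notion of Bochner integral.
\<close>

inductive has_banach_bochner_integral ::
    "'b measure \<Rightarrow> ('b \<Rightarrow> 'a::real_normed_vector) \<Rightarrow> 'a \<Rightarrow> bool"
  for M f y where
  "f \<in> borel_measurable M \<Longrightarrow>
    (\<And>i. Bochner_Integration.simple_bochner_integrable M (s i)) \<Longrightarrow>
    (\<lambda>i::nat. \<integral>\<^sup>+z. norm (f z - s i z) \<partial>M) \<longlonglongrightarrow> 0 \<Longrightarrow>
    (\<lambda>i. Bochner_Integration.simple_bochner_integral M (s i)) \<longlonglongrightarrow> y \<Longrightarrow>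
    has_banach_bochner_integral M f y"

lemma has_banach_bochner_integral_eq_has_bochner_integral:
  fixes f :: "'b \<Rightarrow> 'a::{real_normed_vector, second_countable_topology}"
  shows "has_banach_bochner_integral M f y \<longleftrightarrow> has_bochner_integral M f y"
  by (auto simp: has_banach_bochner_integral.simps has_bochner_integral.simps)

definition banach_bochner_integrable :: "'b measure \<Rightarrow> ('b \<Rightarrow> 'a::real_normed_vector) \<Rightarrow> bool" where
  "banach_bochner_integrable M f \<longleftrightarrow> (\<exists>y. has_banach_bochner_integral M f y)"

definition banach_bochner_integral :: "'b measure \<Rightarrow> ('b \<Rightarrow> 'a::real_normed_vector) \<Rightarrow> 'a" where
  "banach_bochner_integral M f =
    (if banach_bochner_integrable M f then THE y. has_banach_bochner_integral M f y else 0)"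

text \<open>Derivatives are taken within \<open>S\<close>; for \<open>S = {0..T}\<close> they are one-sided at the end points.\<close>

definition nth_vector_derivative ::
    "real set \<Rightarrow> nat \<Rightarrow> (real \<Rightarrow> 'a::real_normed_vector) \<Rightarrow> real \<Rightarrow> 'a" where
  "nth_vector_derivative S n x = ((\<lambda>f t. vector_derivative f (at t within S)) ^^ n) x"

definition Ck_on :: "nat \<Rightarrow> real set \<Rightarrow> (real \<Rightarrow> 'a::real_normed_vector) \<Rightarrow> bool" where
  "Ck_on n S x \<longleftrightarrow>
    (\<forall>i<n. \<forall>t\<in>S. nth_vector_derivative S i x differentiable (at t within S)) \<and>
    continuous_on S (nth_vector_derivative S n x)"

definition caputo_derivative ::
    "real \<Rightarrow> real \<Rightarrow> (real \<Rightarrow> 'a::real_normed_vector) \<Rightarrow> real \<Rightarrow> 'a" where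
  "caputo_derivative T \<nu> x t =
    (let n = nat \<lceil>\<nu>\<rceil> in
     if \<nu> = real n then nth_vector_derivative {0..T} n x t
     else (1 / Gamma (real n - \<nu>)) *\<^sub>R
       banach_bochner_integral (lebesgue_on {0..t})
         (\<lambda>s. ((t - s) powr (real n - \<nu> - 1)) *\<^sub>R nth_vector_derivative {0..T} n x s))"

definition mild_solution ::
    "real \<Rightarrow> real \<Rightarrow> real \<Rightarrow> ('a::banach \<Rightarrow>\<^sub>L 'a) \<Rightarrow> ('a \<Rightarrow>\<^sub>L 'a) \<Rightarrow> (real \<Rightarrow> 'a) \<Rightarrow> 'a \<Rightarrow> 'a
      \<Rightarrow> (real \<Rightarrow> 'a) \<Rightarrow> bool" where
  "mild_solution T \<alpha> \<beta> A B g \<eta> \<eta>' x \<longleftrightarrow>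
    Ck_on 2 {0..T} x \<and>
    (\<forall>t\<in>{0<..T}. caputo_derivative T \<alpha> x t - A (caputo_derivative T \<beta> x t) = B (x t) + g t) \<and>
    x 0 = \<eta> \<and>
    vector_derivative x (at 0 within {0..T}) = \<eta>'"

definition blinfun_power :: "('a::real_normed_vector \<Rightarrow>\<^sub>L 'a) \<Rightarrow> nat \<Rightarrow> ('a \<Rightarrow>\<^sub>L 'a)" where
  "blinfun_power A k = ((o\<^sub>L) A ^^ k) id_blinfun"

text \<open>
  The three double series of the representation formula have the common shape
  \<open>\<Sum>k m. binom(k+m,m) A^k B^(m+j) t^(k(\<alpha>-\<beta>)+m\<alpha>+p) / \<Gamma>(k(\<alpha>-\<beta>)+m\<alpha>+q)\<close>.
\<close>

definition ml_term ::
    "('a::real_normed_vector \<Rightarrow>\<^sub>L 'a) \<Rightarrow> ('a \<Rightarrow>\<^sub>L 'a) \<Rightarrow> real \<Rightarrow> real \<Rightarrow> nat \<Rightarrow> real \<Rightarrow> real \<Rightarrow> real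
      \<Rightarrow> nat \<Rightarrow> nat \<Rightarrow> ('a \<Rightarrow>\<^sub>L 'a)" where
  "ml_term A B \<alpha> \<beta> j p q t k m =
    (real ((k + m) choose m) *
      (t powr (real k * (\<alpha> - \<beta>) + real m * \<alpha> + p) / Gamma (real k * (\<alpha> - \<beta>) + real m * \<alpha> + q)))
    *\<^sub>R (blinfun_power A k o\<^sub>L blinfun_power B (m + j))"

text \<open>Convergence of \<open>\<Sum>k. \<Sum>m. c k m\<close>; \<open>suminf\<close> is meaningless without it.\<close>

definition iterated_summable :: "(nat \<Rightarrow> nat \<Rightarrow> 'a::real_normed_vector) \<Rightarrow> bool" where
  "iterated_summable c \<longleftrightarrow> (\<forall>k. summable (c k)) \<and> summable (\<lambda>k. \<Sum>m. c k m)"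

end

theory Submission
  imports Defs
begin

text \<open>
  Put \<open>z = x - \<eta>\<close>, \<open>\<gamma> = \<alpha> - \<beta>\<close>, and let \<open>J\<^sup>a\<close> be the Riemann--Liouville integral of order \<open>a\<close>. For a
  function in \<open>C\<^sup>2\<close> the two Caputo derivatives are \<open>J\<^bsup>2-\<alpha>\<^esup> x''\<close> and \<open>J\<^bsup>1-\<beta>\<^esup> x'\<close>. Applying \<open>J\<^sup>\<alpha>\<close> to the
  equation and using \<open>J\<^sup>a J\<^sup>b = J\<^bsup>a+b\<^esup>\<close> removes all derivatives and leaves a Volterra equation
  (\<open>mild_solution_volterra\<close>)
    \<open>z = f + A J\<^sup>\<gamma> z + B J\<^sup>\<alpha> z\<close>,  \<open>f(t) = t \<eta>' + t\<^sup>\<alpha>/\<Gamma>(\<alpha>+1) B \<eta> + J\<^sup>\<alpha> g(t)\<close>.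
  The Caputo derivatives do not change when the constant \<open>\<eta>\<close> is subtracted from \<open>x\<close>, so \<open>\<eta>\<close> enters \<open>f\<close>
  only through \<open>B\<close>; this is why the series applied to \<open>\<eta>\<close> has the factor \<open>B\<^bsup>m+1\<^esup>\<close>.

  Since \<open>A\<close>, \<open>B\<close> and the fractional integrals all commute, the \<open>n\<close>-th iterate of
  \<open>A J\<^sup>\<gamma> + B J\<^sup>\<alpha>\<close> expands by Pascal's rule into \<open>\<Sum>\<^sub>k binom(n,k) A\<^sup>k B\<^bsup>n-k\<^esup> J\<^bsup>k\<gamma>+(n-k)\<alpha>\<^esup>\<close>
  (\<open>neumann_term_Suc\<close>). The operator \<open>J\<^sup>e\<close> has norm at most \<open>t\<^sup>e/\<Gamma>(e+1)\<close>, and \<open>\<Gamma>\<close> grows faster than any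
  exponential; hence the binomial sums decay geometrically in \<open>n\<close>
  (\<open>frac_monomial_geometric_bound\<close>). This makes the remainder of the Neumann series vanish
  (\<open>volterra_neumann_series\<close>) and makes the double series absolutely summable, so that summing over
  the diagonals \<open>k + m = n\<close> gives the same value as the iterated sum
  (\<open>double_series_binomial_majorant\<close>). Evaluating the iterates at \<open>f\<close> by \<open>J\<^sup>e (t\<^sup>p/\<Gamma>(p+1)) = t\<^bsup>e+p\<^esup>/\<Gamma>(e+p+1)\<close>
  produces exactly the three series (\<open>neumann_term_forcing\<close>).

  The values are in an arbitrary, possibly non-separable Banach space. The Bochner integrals are
  therefore first identified with Henstock--Kurzweil integrals
  (\<open>has_banach_bochner_integral_imp_has_integral\<close>), for which linearity, norm bounds and the
  fundamental theorem of calculus hold with values in any Banach space. The semigroup law for \<open>J\<close>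
  is obtained without Fubini's theorem: it holds on monomials by the Beta integral, and monomials
  span a dense subspace of the continuous functions (\<open>continuous_on_monomial_induct\<close>).
\<close>

section \<open>Bochner integrals over intervals\<close>

text \<open>
  Differences of Borel functions need not be Borel measurable in a non-separable space. Here the
  subtracted function takes finitely many values, so it suffices to look at each of them.
\<close>

lemma borel_measurable_norm_diff_simple:
  fixes f s :: "'b \<Rightarrow> 'a::real_normed_vector"
  assumes f: "f \<in> borel_measurable M" and s: "simple_function M s"
  shows "(\<lambda>x. norm (f x - s x)) \<in> borel_measurable M"
proof (rule measurable_compose_countable'[where g = s and I = "s ` space M"
        and f = "\<lambda>i x. norm (f x - i)"])
  show "(\<lambda>x. norm (f x - i)) \<in> borel_measurable M" for i
    by (rule borel_measurable_continuous_on[OF _ f]) (intro continuous_intros)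
  show "s \<in> measurable M (count_space (s ` space M))"
    using s by (auto simp: measurable_count_space_eq2 simple_function_def)
  show "countable (s ` space M)"
    using s by (simp add: simple_function_def uncountable_infinite countable_finite)
qed

lemma has_integral_simple_bochner_integral:
  fixes s :: "real \<Rightarrow> 'a::real_normed_vector"
  assumes "simple_function (lebesgue_on {a..b}) s"
  shows "(s has_integral Bochner_Integration.simple_bochner_integral (lebesgue_on {a..b}) s) {a..b}"
proof -
  let ?M = "lebesgue_on {a..b}"
  define E where "E y = {x \<in> space ?M. s x = y}" for y
  have fin: "finite (s ` space ?M)"
    using assms by (simp add: simple_function_def)
  have E: "E y \<in> sets ?M" for y
    using simple_functionD(2)[OF assms, of "{y}"]
    by (simp add: E_def vimage_def Int_def conj_commute)
  have "((\<lambda>x. indicat_real (E y) x) has_integral measure ?M (E y)) {a..b}" for y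
  proof -
    have "integrable ?M (indicat_real (E y))"
      using E[of y] by (intro integrable_real_indicator)
        (auto simp: emeasure_restrict_space less_top[symmetric] intro!: finite_measure.emeasure_finite finite_measure_lebesgue_on)
    from has_integral_integral_lebesgue_on[OF this] show ?thesis
      using sets.sets_into_space[OF E[of y]] by (simp add: Int_absorb2)
  qed
  then have int: "((\<lambda>x. \<Sum>y\<in>s ` space ?M. indicat_real (E y) x *\<^sub>R y)
      has_integral (\<Sum>y\<in>s ` space ?M. measure ?M (E y) *\<^sub>R y)) {a..b}"
    by (intro has_integral_sum fin has_integral_scaleR_left)
  have eq: "(\<Sum>y\<in>s ` space ?M. indicat_real (E y) x *\<^sub>R y) = s x" if "x \<in> {a..b}" for x
  proof -
    have "(\<Sum>y\<in>s ` space ?M. indicat_real (E y) x *\<^sub>R y) = (\<Sum>y\<in>s ` space ?M. if y = s x then s x else 0)"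
      using that by (intro sum.cong) (auto simp: E_def indicator_def)
    also have "\<dots> = s x"
      using fin that by (subst sum.delta) auto
    finally show ?thesis .
  qed
  show ?thesis
    unfolding simple_bochner_integral_def E_def[symmetric] by (rule has_integral_eq[OF eq int])
qed

text \<open>
  A Riemann sum of \<open>f - s\<^sub>i\<close> is bounded in norm by the Riemann sum of the scalar function
  \<open>|f - s\<^sub>i|\<close>, and the latter is close to \<open>d\<^sub>i\<close> on fine divisions. Hence \<open>L\<^sup>1\<close>-approximation transfers
  Henstock--Kurzweil integrability whenever the distance itself is integrable.
\<close>

lemma has_integral_L1_limit:
  fixes f :: "real \<Rightarrow> 'a::real_normed_vector"
  assumes s: "\<And>i. (s i has_integral c i) {a..b}"
    and d: "\<And>i. ((\<lambda>x. norm (f x - s i x)) has_integral d i) {a..b}"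
    and d0: "d \<longlonglongrightarrow> 0" and c: "c \<longlonglongrightarrow> y"
  shows "(f has_integral y) {a..b}"
  unfolding has_integral_real
proof (intro allI impI)
  fix e :: real assume "0 < e"
  then have e4: "0 < e / 4" by simp
  have "\<forall>\<^sub>F i in sequentially. dist (d i) 0 < e / 4 \<and> dist (c i) y < e / 4"
    using tendstoD[OF d0 e4] tendstoD[OF c e4] by eventually_elim simp
  then obtain i where di: "\<bar>d i\<bar> < e / 4" and ci: "norm (c i - y) < e / 4"
    by (auto simp: eventually_sequentially dist_norm)
  obtain \<gamma> where \<gamma>: "gauge \<gamma>" and sums_s: "\<And>\<D>. \<D> tagged_division_of {a..b} \<Longrightarrow> \<gamma> fine \<D> \<Longrightarrow>
      norm ((\<Sum>(x,k)\<in>\<D>. measure lborel k *\<^sub>R s i x) - c i) < e / 4"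
    using s[of i, unfolded has_integral_real, rule_format, OF e4] by (elim exE conjE) (rule that, auto)
  obtain \<delta> where \<delta>: "gauge \<delta>" and sums_d: "\<And>\<D>. \<D> tagged_division_of {a..b} \<Longrightarrow> \<delta> fine \<D> \<Longrightarrow>
      norm ((\<Sum>(x,k)\<in>\<D>. measure lborel k *\<^sub>R norm (f x - s i x)) - d i) < e / 4"
    using d[of i, unfolded has_integral_real, rule_format, OF e4] by (elim exE conjE) (rule that, auto)
  show "\<exists>\<gamma>. gauge \<gamma> \<and> (\<forall>\<D>. \<D> tagged_division_of {a..b} \<and> \<gamma> fine \<D> \<longrightarrow>
      norm ((\<Sum>(x,k)\<in>\<D>. measure lborel k *\<^sub>R f x) - y) < e)"
  proof (intro exI conjI allI impI)
    show "gauge (\<lambda>x. \<gamma> x \<inter> \<delta> x)" using \<gamma> \<delta> by (rule gauge_Int)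
    fix \<D> assume "\<D> tagged_division_of {a..b} \<and> (\<lambda>x. \<gamma> x \<inter> \<delta> x) fine \<D>"
    then have D: "\<D> tagged_division_of {a..b}" "\<gamma> fine \<D>" "\<delta> fine \<D>"
      by (auto simp: fine_Int)
    let ?S = "\<lambda>u. \<Sum>(x,k)\<in>\<D>. measure lborel k *\<^sub>R u x"
    have split: "?S f - y = ?S (\<lambda>x. f x - s i x) + (?S (s i) - c i) + (c i - y)"
      by (simp add: split_def scaleR_diff_right sum_subtractf)
    have "norm (?S (\<lambda>x. f x - s i x)) \<le> (\<Sum>(x,k)\<in>\<D>. measure lborel k *\<^sub>R norm (f x - s i x))"
      by (rule order_trans[OF norm_sum]) (auto intro!: sum_mono)
    also have "\<dots> < e / 2"
      using sums_d[OF D(1,3)] di by (simp add: abs_if split: if_splits)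
    finally have "norm (?S (\<lambda>x. f x - s i x)) < e / 2" .
    then show "norm (?S f - y) < e"
      unfolding split using sums_s[OF D(1,2)] ci
        norm_triangle_ineq[of "?S (\<lambda>x. f x - s i x) + (?S (s i) - c i)" "c i - y"]
        norm_triangle_ineq[of "?S (\<lambda>x. f x - s i x)" "?S (s i) - c i"] by linarith
  qed
qed

text \<open>
  Finitely many of the distances may be infinite, whence the threshold \<open>N\<close>.
\<close>

lemma L1_distance_has_integral:
  fixes f :: "real \<Rightarrow> 'a::real_normed_vector"
  assumes f: "f \<in> borel_measurable (lebesgue_on {a..b})"
    and s: "\<And>i::nat. simple_function (lebesgue_on {a..b}) (s i)"
    and lim: "(\<lambda>i. \<integral>\<^sup>+z. norm (f z - s i z) \<partial>lebesgue_on {a..b}) \<longlonglongrightarrow> 0"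
  obtains N d where "\<And>i. i \<ge> N \<Longrightarrow> ((\<lambda>x. norm (f x - s i x)) has_integral d i) {a..b}"
    and "d \<longlonglongrightarrow> 0"
proof -
  let ?M = "lebesgue_on {a..b}"
  let ?I = "\<lambda>i. \<integral>\<^sup>+z. norm (f z - s i z) \<partial>?M"
  have meas: "(\<lambda>x. norm (f x - s i x)) \<in> borel_measurable ?M" for i
    by (rule borel_measurable_norm_diff_simple[OF f s])
  have "\<forall>\<^sub>F i in sequentially. ?I i < 1"
    using lim by (rule order_tendstoD) simp
  then obtain N where N: "\<And>i. i \<ge> N \<Longrightarrow> ?I i < 1"
    by (auto simp: eventually_sequentially)
  show ?thesis
  proof (rule that)
    fix i assume "i \<ge> N"
    have "integrable ?M (\<lambda>x. norm (f x - s i x))"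
      unfolding integrable_iff_bounded
      using meas[of i] order_less_trans[OF N[OF \<open>i \<ge> N\<close>] ennreal_one_less_top] by simp
    moreover from this have "enn2real (?I i) = (\<integral>x. norm (f x - s i x) \<partial>?M)"
      by (simp add: integral_eq_nn_integral)
    ultimately show "((\<lambda>x. norm (f x - s i x)) has_integral enn2real (?I i)) {a..b}"
      using has_integral_integral_lebesgue_on[of "{a..b}" "\<lambda>x. norm (f x - s i x)"] by simp
  next
    show "(\<lambda>i. enn2real (?I i)) \<longlonglongrightarrow> 0"
      by (rule tendsto_enn2real) (use lim in simp_all)
  qed
qed

text \<open>
  This implication also shows that the value of the Bochner integral is unique, because that of
  the Henstock--Kurzweil integral is.
\<close>

lemma has_banach_bochner_integral_imp_has_integral:
  fixes f :: "real \<Rightarrow> 'a::real_normed_vector"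
  assumes "has_banach_bochner_integral (lebesgue_on {a..b}) f y"
  shows "(f has_integral y) {a..b}"
  using assms
proof cases
  case (1 s)
  have sf: "simple_function (lebesgue_on {a..b}) (s i)" for i
    using 1(2)[of i] by (auto elim: simple_bochner_integrable.cases)
  obtain N d where d: "\<And>i. i \<ge> N \<Longrightarrow> ((\<lambda>x. norm (f x - s i x)) has_integral d i) {a..b}"
    and d0: "d \<longlonglongrightarrow> 0"
    by (rule L1_distance_has_integral[OF 1(1) sf 1(3)], rule that)
  show ?thesis
  proof (rule has_integral_L1_limit)
    show "(s (i + N) has_integral Bochner_Integration.simple_bochner_integral (lebesgue_on {a..b}) (s (i + N))) {a..b}" for i
      by (rule has_integral_simple_bochner_integral[OF sf])
    show "((\<lambda>x. norm (f x - s (i + N) x)) has_integral d (i + N)) {a..b}" for i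
      by (rule d) simp
    show "(\<lambda>i. d (i + N)) \<longlonglongrightarrow> 0" using d0 by (rule LIMSEQ_ignore_initial_segment)
    show "(\<lambda>i. Bochner_Integration.simple_bochner_integral (lebesgue_on {a..b}) (s (i + N))) \<longlonglongrightarrow> y"
      using 1(4) by (rule LIMSEQ_ignore_initial_segment)
  qed
qed

lemma banach_bochner_integral_eq_integral:
  fixes f :: "real \<Rightarrow> 'a::real_normed_vector"
  assumes "banach_bochner_integrable (lebesgue_on {a..b}) f"
  shows "banach_bochner_integral (lebesgue_on {a..b}) f = integral {a..b} f"
    and "f integrable_on {a..b}"
proof -
  obtain y where y: "has_banach_bochner_integral (lebesgue_on {a..b}) f y"
    using assms by (auto simp: banach_bochner_integrable_def)
  have "(THE y. has_banach_bochner_integral (lebesgue_on {a..b}) f y) = y"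
    using y by (rule the_equality)
      (metis has_banach_bochner_integral_imp_has_integral has_integral_unique y)
  then show "banach_bochner_integral (lebesgue_on {a..b}) f = integral {a..b} f"
    using has_banach_bochner_integral_imp_has_integral[OF y] assms
    by (simp add: banach_bochner_integral_def integral_unique)
  show "f integrable_on {a..b}"
    using has_banach_bochner_integral_imp_has_integral[OF y] by blast
qed

text \<open>
  Fractional integrals of order below 1 have unbounded kernels, so uniform approximation of the product does
  not help. Instead, \<open>k\<close> and the identity are approximated pointwise by simple real functions
  \<open>\<sigma>\<^sub>i\<close> and \<open>\<theta>\<^sub>i\<close>; then \<open>\<sigma>\<^sub>i (u \<circ> \<theta>\<^sub>i)\<close> is simple, converges pointwise to \<open>k u\<close> by continuity of
  \<open>u\<close>, and is dominated by a multiple of \<open>|k|\<close>. Completeness of the space provides the value of the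
  integral.
\<close>

lemma banach_bochner_integrable_scaleR_continuous:
  fixes k :: "real \<Rightarrow> real" and u :: "real \<Rightarrow> 'a::banach"
  assumes ab: "a \<le> b" and k: "integrable (lebesgue_on {a..b}) k" and u: "continuous_on {a..b} u"
  shows "banach_bochner_integrable (lebesgue_on {a..b}) (\<lambda>x. k x *\<^sub>R u x)"
proof -
  let ?M = "lebesgue_on {a..b}"
  let ?f = "\<lambda>x. k x *\<^sub>R u x"
  have "bounded (u ` {a..b})"
    by (intro compact_imp_bounded compact_continuous_image u compact_Icc)
  then obtain C where C: "\<And>x. x \<in> {a..b} \<Longrightarrow> norm (u x) \<le> C"
    unfolding bounded_iff by blast
  then have "0 \<le> C" using order_trans[OF norm_ge_zero C[of a]] ab by simp
  obtain \<sigma> where \<sigma>: "\<And>i. simple_function ?M (\<sigma> i)"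
    "\<And>i. emeasure ?M {x \<in> space ?M. \<sigma> i x \<noteq> 0} \<noteq> \<infinity>"
    "\<And>x. x \<in> space ?M \<Longrightarrow> (\<lambda>i. \<sigma> i x) \<longlonglongrightarrow> k x"
    "\<And>x i. x \<in> space ?M \<Longrightarrow> norm (\<sigma> i x) \<le> 2 * norm (k x)"
    by (rule integrable_implies_simple_function_sequence[OF k], rule that)
  have ident: "integrable ?M (\<lambda>x. x)"
    by (rule continuous_imp_integrable_real) (rule continuous_intros)
  obtain \<theta> where \<theta>: "\<And>i. simple_function ?M (\<theta> i)"
    "\<And>i. emeasure ?M {x \<in> space ?M. \<theta> i x \<noteq> 0} \<noteq> \<infinity>"
    "\<And>x. x \<in> space ?M \<Longrightarrow> (\<lambda>i. \<theta> i x) \<longlonglongrightarrow> x"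
    "\<And>x i. x \<in> space ?M \<Longrightarrow> norm (\<theta> i x) \<le> 2 * norm x"
    by (rule integrable_implies_simple_function_sequence[OF ident], rule that)
  \<comment> \<open>The values of \<open>\<theta>\<^sub>i\<close> may leave the interval, so they are clamped before \<open>u\<close> is applied.\<close>
  define c where "c x = max a (min b x)" for x
  have c_in: "c x \<in> {a..b}" for x using ab by (auto simp: c_def)
  have c_id: "c x = x" if "x \<in> {a..b}" for x using that by (auto simp: c_def)
  have uc: "continuous_on UNIV (u \<circ> c)"
    unfolding c_def
    by (intro continuous_on_compose continuous_intros continuous_on_subset[OF u])
       (use ab in auto)
  define s where "s i x = \<sigma> i x *\<^sub>R u (c (\<theta> i x))" for i x
  have sf: "simple_function ?M (s i)" for i
    unfolding s_def
    by (rule simple_function_compose2[where h = scaleR, OF \<sigma>(1)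
          simple_function_compose1[where g = "\<lambda>x. u (c x)", OF \<theta>(1)]])
  have s_lim: "(\<lambda>i. s i x) \<longlonglongrightarrow> ?f x" if "x \<in> space ?M" for x
  proof -
    have "(\<lambda>i. (u \<circ> c) (\<theta> i x)) \<longlonglongrightarrow> (u \<circ> c) x"
      using uc \<theta>(3)[OF that] by (auto intro: continuous_on_tendsto_compose)
    then show ?thesis
      unfolding s_def using \<sigma>(3)[OF that] c_id that by (auto intro!: tendsto_scaleR)
  qed
  have s_bound: "norm (s i x) \<le> 2 * \<bar>k x\<bar> * C" if "x \<in> space ?M" for i x
    unfolding s_def norm_scaleR
    using \<sigma>(4)[OF that, of i] C[OF c_in, of "\<theta> i x"] by (intro mult_mono) auto
  have f_bound: "norm (?f x) \<le> \<bar>k x\<bar> * C" if "x \<in> space ?M" for x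
    using C[of x] that by (simp add: mult_left_mono)
  have f: "?f \<in> borel_measurable ?M"
    by (rule borel_measurable_LIMSEQ_metric[OF borel_measurable_simple_function[OF sf] s_lim])
  have diff: "norm (?f x - s i x) \<le> 3 * C * \<bar>k x\<bar>" if "x \<in> space ?M" for i x
    using s_bound[OF that, of i] f_bound[OF that] norm_triangle_ineq4[of "?f x" "s i x"]
    by (simp add: algebra_simps)
  have L1: "(\<lambda>i. \<integral>\<^sup>+x. norm (?f x - s i x) \<partial>?M) \<longlonglongrightarrow> (\<integral>\<^sup>+x. 0 \<partial>?M)"
  proof (rule nn_integral_dominated_convergence[where w = "\<lambda>x. ennreal (3 * C * \<bar>k x\<bar>)"])
    show "(\<lambda>x. ennreal (norm (?f x - s i x))) \<in> borel_measurable ?M" for i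
      using borel_measurable_norm_diff_simple[OF f sf] by measurable
    show "(\<lambda>x. ennreal (3 * C * \<bar>k x\<bar>)) \<in> borel_measurable ?M"
      using borel_measurable_integrable[OF k] by measurable
    show "AE x in ?M. ennreal (norm (?f x - s i x)) \<le> ennreal (3 * C * \<bar>k x\<bar>)" for i
      using diff by (intro AE_I2 ennreal_leI) auto
    have "integrable ?M (\<lambda>x. 3 * C * \<bar>k x\<bar>)" using k by auto
    then have "(\<integral>\<^sup>+x. ennreal (norm (3 * C * \<bar>k x\<bar>)) \<partial>?M) < \<infinity>"
      unfolding integrable_iff_bounded by blast
    moreover have "norm (3 * C * \<bar>k x\<bar>) = 3 * C * \<bar>k x\<bar>" for x
      using \<open>0 \<le> C\<close> by (simp add: abs_mult)
    ultimately show "(\<integral>\<^sup>+x. ennreal (3 * C * \<bar>k x\<bar>) \<partial>?M) < \<infinity>" by simp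
    show "AE x in ?M. (\<lambda>i. ennreal (norm (?f x - s i x))) \<longlonglongrightarrow> 0"
    proof (rule AE_I2)
      fix x assume "x \<in> space ?M"
      from tendsto_norm_zero[OF LIM_zero[OF s_lim[OF this]]]
      have "(\<lambda>i. norm (?f x - s i x)) \<longlonglongrightarrow> 0" by (simp add: norm_minus_commute)
      from tendsto_ennrealI[OF this] show "(\<lambda>i. ennreal (norm (?f x - s i x))) \<longlonglongrightarrow> 0" by simp
    qed
  qed simp
  then have L1: "(\<lambda>i. \<integral>\<^sup>+x. norm (?f x - s i x) \<partial>?M) \<longlonglongrightarrow> 0" by simp
  have fm: "emeasure ?M A \<noteq> \<infinity>" for A
    using finite_measure.emeasure_finite[OF finite_measure_lebesgue_on] by auto
  have sb: "Bochner_Integration.simple_bochner_integrable ?M (s i)" for i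
    using sf fm by (rule simple_bochner_integrable.intros)
  let ?c = "\<lambda>i. Bochner_Integration.simple_bochner_integral ?M (s i)"
  obtain N d where d: "\<And>i. i \<ge> N \<Longrightarrow> ((\<lambda>x. norm (?f x - s i x)) has_integral d i) {a..b}"
    and d0: "d \<longlonglongrightarrow> 0"
    by (rule L1_distance_has_integral[OF f sf L1], rule that)
  have dist_c: "norm (?c i - ?c j) \<le> d i + d j" if "i \<ge> N" "j \<ge> N" for i j
  proof -
    have S: "((\<lambda>x. s i x - s j x) has_integral (?c i - ?c j)) {a..b}"
      by (intro has_integral_diff has_integral_simple_bochner_integral sf)
    have D: "((\<lambda>x. norm (?f x - s i x) + norm (?f x - s j x)) has_integral (d i + d j)) {a..b}"
      by (intro has_integral_add d that)
    have "norm (s i x - s j x) \<le> norm (?f x - s i x) + norm (?f x - s j x)" for x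
      using norm_triangle_ineq4[of "?f x - s j x" "?f x - s i x"] by simp
    then have "norm (integral {a..b} (\<lambda>x. s i x - s j x))
        \<le> integral {a..b} (\<lambda>x. norm (?f x - s i x) + norm (?f x - s j x))"
      using S D by (intro Henstock_Kurzweil_Integration.integral_norm_bound_integral) blast+
    then show "norm (?c i - ?c j) \<le> d i + d j"
      using integral_unique[OF S] integral_unique[OF D] by simp
  qed
  have "Cauchy ?c"
  proof (rule metric_CauchyI)
    fix e :: real assume "0 < e"
    then have "\<forall>\<^sub>F i in sequentially. d i < e / 2"
      using d0 by (intro order_tendstoD) auto
    then obtain N' where N': "\<And>i. i \<ge> N' \<Longrightarrow> d i < e / 2" by (auto simp: eventually_sequentially)
    show "\<exists>M. \<forall>m\<ge>M. \<forall>n\<ge>M. dist (?c m) (?c n) < e"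
    proof (intro exI allI impI)
      fix m n assume "max N N' \<le> m" "max N N' \<le> n"
      then show "dist (?c m) (?c n) < e"
        using dist_c[of m n] N'[of m] N'[of n] by (simp add: dist_norm)
    qed
  qed
  then obtain y where "?c \<longlonglongrightarrow> y"
    using Cauchy_convergent_iff convergentD by blast
  then show ?thesis
    unfolding banach_bochner_integrable_def
    using has_banach_bochner_integral.intros[OF f sb L1] by blast
qed

section \<open>Riemann--Liouville fractional integrals\<close>

text \<open>
  The Riemann--Liouville integral \<open>J\<^sup>a f\<close>. The defining integral diverges at \<open>a = 0\<close>, where the limit
  as \<open>a\<close> tends to 0 is the identity.
\<close>

definition frac_integral :: "real \<Rightarrow> (real \<Rightarrow> 'a::banach) \<Rightarrow> real \<Rightarrow> 'a" where
  "frac_integral a f t =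
    (if a = 0 then f t else integral {0..t} (\<lambda>s. ((t - s) powr (a - 1) / Gamma a) *\<^sub>R f s))"

text \<open>
  The powers normalised such that \<open>J\<^sup>a\<close> adds \<open>a\<close> to the index. The case \<open>b = 0\<close> is separate because
  \<open>0 powr 0 = 0\<close>, while the constant function 1 is wanted also at 0.
\<close>

definition frac_monomial :: "real \<Rightarrow> real \<Rightarrow> real" where
  "frac_monomial b t = (if b = 0 then 1 else t powr b / Gamma (b + 1))"

lemma frac_monomial_nonneg: "0 \<le> b \<Longrightarrow> 0 \<le> frac_monomial b t"
  using Gamma_real_pos[of "b + 1"] by (simp add: frac_monomial_def)

lemma continuous_on_frac_monomial: "0 \<le> b \<Longrightarrow> continuous_on {0..t} (frac_monomial b)"
proof (cases "b = 0")
  case False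
  assume "0 \<le> b"
  with False have "0 < b" by simp
  then have "0 < Gamma (b + 1)" by (intro Gamma_real_pos) simp
  then have "Gamma (b + 1) \<noteq> 0" by (rule less_imp_neq[symmetric])
  with \<open>0 < b\<close> have "continuous_on {0..t} (\<lambda>t. t powr b / Gamma (b + 1))"
    by (intro continuous_on_divide continuous_on_powr' continuous_intros) auto
  with False show ?thesis by (simp add: frac_monomial_def)
qed (simp add: frac_monomial_def)

lemma power_eq_frac_monomial: "0 \<le> s \<Longrightarrow> s ^ n = fact n * frac_monomial (real n) s"
  using Gamma_fact[of n, where 'a = real]
  by (cases "n = 0") (auto simp: frac_monomial_def add.commute powr_realpow')

text \<open>
  Euler's Beta integral, rescaled from the unit interval to \<open>{0..t}\<close>.
\<close>

lemma has_integral_kernel_frac_monomial: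
  assumes a: "0 < a" and b: "0 \<le> b" and t: "0 \<le> t"
  shows "((\<lambda>s. (t - s) powr (a - 1) / Gamma a * frac_monomial b s)
    has_integral frac_monomial (a + b) t) {0..t}"
proof (cases "t = 0")
  case True
  moreover have "frac_monomial (a + b) 0 = 0"
    using a b by (simp add: frac_monomial_def)
  ultimately show ?thesis
    using has_integral_refl(1)[of _ "0::real"] by (simp only: box_real)
next
  case False
  with t have t: "0 < t" by simp
  \<comment> \<open>Factoring \<open>t\<close> out of both powers and substituting \<open>s = t u\<close> leaves this constant.\<close>
  define c where "c = t powr (a + b - 1) / (Gamma a * Gamma (b + 1))"
  have G: "Gamma a > 0" "Gamma (b + 1) > 0" "Gamma (a + b + 1) > 0"
    using a b by (auto intro!: Gamma_real_pos)
  have "((\<lambda>u. u powr (b + 1 - 1) * (1 - u) powr (a - 1)) has_integral Beta (b + 1) a) (cbox 0 1)"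
    unfolding box_real using a b by (intro has_integral_Beta_real) auto
  from has_integral_affinity'[OF this, of "1 / t" 0] t
  have "((\<lambda>s. (s / t) powr b * (1 - s / t) powr (a - 1)) has_integral (t * Beta (b + 1) a)) {0..t}"
    by (simp add: divide_inverse mult.commute)
  from has_integral_mult_right[OF this, of c]
  have int: "((\<lambda>s. c * ((s / t) powr b * (1 - s / t) powr (a - 1)))
      has_integral (c * (t * Beta (b + 1) a))) {0..t}" .
  have val: "c * (t * Beta (b + 1) a) = frac_monomial (a + b) t"
  proof -
    have "t powr (a + b - 1) * t = t powr (a + b)"
      using t by (simp add: powr_diff)
    moreover have "a + b \<noteq> 0" using a b by simp
    ultimately show ?thesis
      using G by (simp add: c_def Beta_def frac_monomial_def ac_simps)
  qed
  have eq: "(t - s) powr (a - 1) / Gamma a * frac_monomial b s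
      = c * ((s / t) powr b * (1 - s / t) powr (a - 1))" if "s \<in> {0..t} - {0}" for s
  proof -
    have "(1 - s / t) = (t - s) / t" using t by (simp add: field_simps)
    then have "(1 - s / t) powr (a - 1) = (t - s) powr (a - 1) / t powr (a - 1)"
      using that t by (simp add: powr_divide)
    moreover have "(s / t) powr b = s powr b / t powr b"
      using that t by (simp add: powr_divide)
    moreover have "t powr (a + b - 1) = t powr (a - 1) * t powr b"
      by (simp add: powr_add[symmetric] algebra_simps)
    moreover have "frac_monomial b s = s powr b / Gamma (b + 1)"
      using that by (simp add: frac_monomial_def)
    ultimately show ?thesis
      using t G by (simp add: c_def)
  qed
  show ?thesis
    by (rule has_integral_spike[OF negligible_sing eq int[unfolded val]])
qed

lemma has_integral_kernel:
  assumes "0 < a" and "0 \<le> t"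
  shows "((\<lambda>s. (t - s) powr (a - 1) / Gamma a) has_integral frac_monomial a t) {0..t}"
  using has_integral_kernel_frac_monomial[of a 0 t] assms by (simp add: frac_monomial_def[of 0])

lemma integrable_lebesgue_on_kernel:
  fixes a t :: real
  assumes "0 < a" and "0 \<le> t"
  shows "integrable (lebesgue_on {0..t}) (\<lambda>s. (t - s) powr (a - 1) / Gamma a)"
proof (rule absolutely_integrable_imp_integrable)
  show "(\<lambda>s. (t - s) powr (a - 1) / Gamma a) absolutely_integrable_on {0..t}"
    using has_integral_kernel[OF assms] Gamma_real_pos[OF assms(1)]
    by (intro nonnegative_absolutely_integrable_1) (auto simp: has_integral_iff)
qed simp

lemma banach_bochner_integrable_kernel:
  fixes f :: "real \<Rightarrow> 'a::banach"
  assumes "0 < a" and "0 \<le> t" and "continuous_on {0..t} f"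
  shows "banach_bochner_integrable (lebesgue_on {0..t}) (\<lambda>s. ((t - s) powr (a - 1) / Gamma a) *\<^sub>R f s)"
  using assms by (intro banach_bochner_integrable_scaleR_continuous integrable_lebesgue_on_kernel)

lemma kernel_integrable_on:
  fixes f :: "real \<Rightarrow> 'a::banach"
  assumes "0 < a" and "0 \<le> t" and "continuous_on {0..t} f"
  shows "(\<lambda>s. ((t - s) powr (a - 1) / Gamma a) *\<^sub>R f s) integrable_on {0..t}"
  by (rule banach_bochner_integral_eq_integral(2)[OF banach_bochner_integrable_kernel[OF assms]])

text \<open>
  The factor is the fractional integral of the constant function 1.
\<close>

lemma norm_frac_integral_le:
  fixes f :: "real \<Rightarrow> 'a::banach"
  assumes a: "0 \<le> a" and t: "0 \<le> t" and f: "continuous_on {0..t} f"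
    and M: "\<And>s. s \<in> {0..t} \<Longrightarrow> norm (f s) \<le> M"
  shows "norm (frac_integral a f t) \<le> frac_monomial a t * M"
proof (cases "a = 0")
  case True
  then show ?thesis using M[of t] t by (simp add: frac_integral_def frac_monomial_def)
next
  case False
  then have a: "0 < a" using a by simp
  have int: "((\<lambda>s. (t - s) powr (a - 1) / Gamma a * M) has_integral frac_monomial a t * M) {0..t}"
    by (intro has_integral_mult_left has_integral_kernel a t)
  have le: "norm (((t - s) powr (a - 1) / Gamma a) *\<^sub>R f s) \<le> (t - s) powr (a - 1) / Gamma a * M"
    if "s \<in> {0..t}" for s
    using M[OF that] Gamma_real_pos[OF a] by (simp add: divide_right_mono mult_left_mono)
  have "norm (integral {0..t} (\<lambda>s. ((t - s) powr (a - 1) / Gamma a) *\<^sub>R f s))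
      \<le> integral {0..t} (\<lambda>s. (t - s) powr (a - 1) / Gamma a * M)"
    by (rule Henstock_Kurzweil_Integration.integral_norm_bound_integral
          [OF kernel_integrable_on[OF a t f] has_integral_integrable[OF int] le])
  then show ?thesis
    unfolding integral_unique[OF int] using a by (simp add: frac_integral_def)
qed

lemma frac_integral_add:
  assumes "0 \<le> a" "0 \<le> t" "continuous_on {0..t} f" "continuous_on {0..t} g"
  shows "frac_integral a (\<lambda>s. f s + g s) t = frac_integral a f t + frac_integral a g t"
  using assms kernel_integrable_on[of a t f] kernel_integrable_on[of a t g]
  by (auto simp: frac_integral_def scaleR_add_right intro!: integral_add)

lemma frac_integral_diff:
  assumes "0 \<le> a" "0 \<le> t" "continuous_on {0..t} f" "continuous_on {0..t} g"
  shows "frac_integral a (\<lambda>s. f s - g s) t = frac_integral a f t - frac_integral a g t"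
  using assms kernel_integrable_on[of a t f] kernel_integrable_on[of a t g]
  by (auto simp: frac_integral_def scaleR_diff_right intro!: integral_diff)

lemma frac_integral_blinfun:
  fixes A :: "'a::banach \<Rightarrow>\<^sub>L 'b::banach"
  assumes "0 \<le> a" "0 \<le> t" "continuous_on {0..t} f"
  shows "frac_integral a (\<lambda>s. A (f s)) t = A (frac_integral a f t)"
  using assms kernel_integrable_on[of a t f]
    integral_linear[OF kernel_integrable_on[of a t f] blinfun.bounded_linear_right[of A]]
  by (auto simp: frac_integral_def o_def blinfun.scaleR_right)

lemma frac_integral_frac_monomial:
  assumes "0 \<le> a" "0 \<le> b" "0 \<le> t"
  shows "frac_integral a (\<lambda>s. frac_monomial b s *\<^sub>R v) t = frac_monomial (a + b) t *\<^sub>R v"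
proof (cases "a = 0")
  case False
  then have "((\<lambda>s. ((t - s) powr (a - 1) / Gamma a * frac_monomial b s) *\<^sub>R v)
      has_integral frac_monomial (a + b) t *\<^sub>R v) {0..t}"
    using assms by (intro has_integral_scaleR_left has_integral_kernel_frac_monomial) auto
  then show ?thesis
    using False by (simp add: frac_integral_def integral_unique)
qed (simp add: frac_integral_def)

lemma frac_integral_cong:
  assumes "0 \<le> t" and "\<And>s. s \<in> {0..t} \<Longrightarrow> f s = g s"
  shows "frac_integral a f t = frac_integral a g t"
  using assms by (auto simp: frac_integral_def intro!: integral_cong)

lemma frac_integral_cong_pos:
  assumes "0 < a" and "0 \<le> t" and "\<And>s. s \<in> {0<..t} \<Longrightarrow> f s = g s"
  shows "frac_integral a f t = frac_integral a g t"
proof -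
  have "integral {0..t} (\<lambda>s. ((t - s) powr (a - 1) / Gamma a) *\<^sub>R f s)
      = integral {0..t} (\<lambda>s. ((t - s) powr (a - 1) / Gamma a) *\<^sub>R g s)"
    by (rule integral_spike[of "{0}"]) (use assms(3) in auto)
  then show ?thesis using assms(1) by (simp add: frac_integral_def)
qed

text \<open>
  Continuity of the fractional integral in the uniform norm is what lets identities pass from
  monomials to all continuous functions.
\<close>

lemma uniform_limit_frac_integral:
  fixes p :: "nat \<Rightarrow> real \<Rightarrow> 'a::banach"
  assumes a: "0 \<le> a" and p: "\<And>n. continuous_on {0..T} (p n)"
    and lim: "uniform_limit {0..T} p f sequentially"
  shows "uniform_limit {0..T} (\<lambda>n. frac_integral a (p n)) (frac_integral a f) sequentially"
proof (rule uniform_limitI)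
  fix e :: real assume "0 < e"
  have f: "continuous_on {0..T} f"
    by (rule uniform_limit_theorem[OF _ lim]) (simp_all add: p)
  have "bounded (frac_monomial a ` {0..T})"
    using a by (intro compact_imp_bounded compact_continuous_image continuous_on_frac_monomial compact_Icc)
  then obtain K where K: "0 < K" "\<And>t. t \<in> {0..T} \<Longrightarrow> norm (frac_monomial a t) \<le> K"
    unfolding bounded_pos by blast
  define d where "d = e / (2 * K)"
  have "0 < d" using \<open>0 < e\<close> K by (simp add: d_def)
  from uniform_limitD[OF lim this]
  show "\<forall>\<^sub>F n in sequentially. \<forall>t\<in>{0..T}. dist (frac_integral a (p n) t) (frac_integral a f t) < e"
  proof eventually_elim
    case (elim n)
    show ?case
    proof
      fix t assume t: "t \<in> {0..T}"
      have c: "continuous_on {0..t} (p n)" "continuous_on {0..t} f"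
        using t by (auto intro: continuous_on_subset[OF p] continuous_on_subset[OF f])
      have "norm (p n s - f s) \<le> d" if "s \<in> {0..t}" for s
        using elim t that by (force simp: dist_norm)
      then have "norm (frac_integral a (\<lambda>s. p n s - f s) t) \<le> frac_monomial a t * d"
        using t a by (intro norm_frac_integral_le continuous_on_diff c) auto
      also have "\<dots> \<le> K * d"
        using K(2)[OF t] \<open>0 < d\<close> by (intro mult_right_mono) auto
      also have "\<dots> < e"
        using \<open>0 < e\<close> K by (simp add: d_def)
      finally show "dist (frac_integral a (p n) t) (frac_integral a f t) < e"
        using t a c by (simp add: frac_integral_diff dist_norm)
    qed
  qed
qed

subsection \<open>Density of polynomials and the semigroup law\<close>

text \<open>
  Chebyshev's inequality for the binomial distribution: near \<open>x\<close> the function varies by less than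
  \<open>e/2\<close>, and the nodes at distance at least \<open>d\<close> carry weight at most \<open>x(1 - x)/(n d\<^sup>2)\<close>. The coefficients
  are scalars, so the argument works for values in any normed space.
\<close>

lemma Bernstein_approximation:
  fixes f :: "real \<Rightarrow> 'a::real_normed_vector"
  assumes f: "continuous_on {0..1} f" and e: "0 < e"
  shows "\<exists>n. \<forall>x\<in>{0..1}. norm (f x - (\<Sum>k\<le>n. Bernstein n k x *\<^sub>R f (k / n))) < e"
proof -
  have "bounded (f ` {0..1})"
    by (intro compact_imp_bounded compact_continuous_image f compact_Icc)
  then obtain M where M: "0 < M" "\<And>x. x \<in> {0..1} \<Longrightarrow> norm (f x) \<le> M"
    unfolding bounded_pos by blast
  have "uniformly_continuous_on {0..1} f"
    using f by (intro compact_uniformly_continuous) auto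
  then obtain d where d: "0 < d"
      "\<And>x y. x \<in> {0..1} \<Longrightarrow> y \<in> {0..1} \<Longrightarrow> dist y x < d \<Longrightarrow> dist (f y) (f x) < e / 2"
    using e unfolding uniformly_continuous_on_def by (meson half_gt_zero)
  \<comment> \<open>With this \<open>n\<close> the tail \<open>2 M / (n d\<^sup>2)\<close> is below \<open>e/2\<close>.\<close>
  obtain n :: nat where n: "4 * M / (e * d\<^sup>2) < real n"
    using reals_Archimedean2 by blast
  moreover have "0 < 4 * M / (e * d\<^sup>2)" using M d e by simp
  ultimately have n0: "0 < n" by (metis less_trans of_nat_0_less_iff)
  have "norm (f x - (\<Sum>k\<le>n. Bernstein n k x *\<^sub>R f (k / n))) < e" if x: "x \<in> {0..1}" for x
  proof -
    define q where "q k = (x - real k / real n)\<^sup>2" for k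
    have B: "0 \<le> Bernstein n k x" for k
      using x by (intro Bernstein_nonneg) auto
    have step: "norm (f x - f (k / n)) \<le> e / 2 + 2 * M / d\<^sup>2 * q k" if "k \<le> n" for k
    proof -
      have kn: "k / n \<in> {0..1}" using that n0 by (auto simp: field_simps)
      show ?thesis
      proof (cases "\<bar>x - k / n\<bar> < d")
        case True
        then have "norm (f x - f (k / n)) < e / 2"
          using d(2)[OF kn x] by (simp add: dist_norm)
        moreover have "0 \<le> 2 * M / d\<^sup>2 * q k" using M by (simp add: q_def)
        ultimately show ?thesis by linarith
      next
        case False
        then have "d\<^sup>2 \<le> q k"
          using d(1) power_mono[of d "\<bar>x - k / n\<bar>" 2] by (simp add: q_def)
        then have "2 * M \<le> 2 * M / d\<^sup>2 * q k"
          using M d(1) by (simp add: field_simps)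
        moreover have "norm (f x - f (k / n)) \<le> 2 * M"
          using norm_triangle_ineq4[of "f x" "f (k / n)"] M(2)[OF x] M(2)[OF kn] by linarith
        ultimately show ?thesis using e by linarith
      qed
    qed
    have var: "(\<Sum>k\<le>n. Bernstein n k x * q k) = x * (1 - x) / n"
    proof -
      have "Bernstein n k x * q k = (real k * (real k - 1) * Bernstein n k x
          + (1 - 2 * (n * x)) * (real k * Bernstein n k x) + (n * x)\<^sup>2 * Bernstein n k x) / n\<^sup>2" for k
        using n0 by (simp add: q_def field_simps power2_eq_square)
      then have "(\<Sum>k\<le>n. Bernstein n k x * q k) = (real n * (real n - 1) * x\<^sup>2
          + (1 - 2 * (n * x)) * (n * x) + (n * x)\<^sup>2) / n\<^sup>2"
        by (simp add: sum_divide_distrib[symmetric] sum.distrib sum_distrib_left[symmetric])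
      also have "\<dots> = x * (1 - x) / n"
        using n0 by (simp add: field_simps power2_eq_square)
      finally show ?thesis .
    qed
    have lin: "(\<Sum>k\<le>n. Bernstein n k x * (E + K * q k))
        = E * (\<Sum>k\<le>n. Bernstein n k x) + K * (\<Sum>k\<le>n. Bernstein n k x * q k)" for E K
      by (simp add: sum_distrib_left sum.distrib algebra_simps del: sum_Bernstein)
    have "f x - (\<Sum>k\<le>n. Bernstein n k x *\<^sub>R f (k / n)) = (\<Sum>k\<le>n. Bernstein n k x *\<^sub>R (f x - f (k / n)))"
      by (simp add: scaleR_diff_right sum_subtractf scaleR_left.sum[symmetric])
    also have "norm \<dots> \<le> (\<Sum>k\<le>n. Bernstein n k x * (e / 2 + 2 * M / d\<^sup>2 * q k))"
    proof (rule sum_norm_le)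
      show "norm (Bernstein n k x *\<^sub>R (f x - f (k / n))) \<le> Bernstein n k x * (e / 2 + 2 * M / d\<^sup>2 * q k)"
        if "k \<in> {..n}" for k
        using mult_left_mono[OF step B, of k k] that B[of k] by simp
    qed
    also have "\<dots> = e / 2 * (\<Sum>k\<le>n. Bernstein n k x) + 2 * M / d\<^sup>2 * (\<Sum>k\<le>n. Bernstein n k x * q k)"
      by (rule lin)
    also have "\<dots> = e / 2 + 2 * M / d\<^sup>2 * (x * (1 - x) / n)"
      by (simp add: var)
    also have "\<dots> \<le> e / 2 + 2 * M / d\<^sup>2 * (1 / n)"
    proof -
      have "x * (1 - x) \<le> 1" using x by (simp add: mult_le_one)
      then show ?thesis using M n0 by (intro add_left_mono mult_left_mono divide_right_mono) auto
    qed
    also have "\<dots> < e"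
      using n n0 e d(1) by (simp add: field_simps)
    finally show ?thesis .
  qed
  then show ?thesis by blast
qed

text \<open>
  A density argument in the form of an induction rule: the Bernstein polynomials of \<open>f\<close> are finite
  sums of monomials with vector coefficients and converge uniformly to \<open>f\<close>.
\<close>

lemma continuous_on_monomial_induct [consumes 2, case_names monomial add limit]:
  fixes f :: "real \<Rightarrow> 'a::real_normed_vector"
  assumes f: "continuous_on {0..T} f" and T: "0 < T"
    and monomial: "\<And>n v. P (\<lambda>s. s ^ n *\<^sub>R v)"
    and add: "\<And>p q. P p \<Longrightarrow> P q \<Longrightarrow> P (\<lambda>s. p s + q s)"
    and limit: "\<And>p g. (\<And>n. P (p n)) \<Longrightarrow> uniform_limit {0..T} p g sequentially \<Longrightarrow> P g"
  shows "P f"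
proof -
  have zero: "P (\<lambda>s. 0)"
    using monomial[of 0 0] by simp
  have sum: "P (\<lambda>s. \<Sum>i\<le>n. q i s)" if "\<And>i. P (q i)" for q and n :: nat
    by (induction n) (auto intro: add that)
  have poly: "P (\<lambda>s. r s *\<^sub>R v)" if r: "real_polynomial_function r" for r :: "real \<Rightarrow> real" and v
  proof -
    obtain a n where "r = (\<lambda>s. \<Sum>i\<le>n. a i * s ^ i)"
      using r unfolding real_polynomial_function_iff_sum by blast
    then have "(\<lambda>s. r s *\<^sub>R v) = (\<lambda>s. \<Sum>i\<le>n. s ^ i *\<^sub>R (a i *\<^sub>R v))"
      by (simp add: scaleR_sum_left mult.commute)
    then show ?thesis by (simp only:) (rule sum, rule monomial)
  qed
  have cf: "continuous_on {0..1} (\<lambda>y. f (T * y))"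
    by (rule continuous_on_compose2[OF f]) (use T in \<open>auto intro!: continuous_intros simp: mult_left_le\<close>)
  have "\<exists>p. P p \<and> (\<forall>s\<in>{0..T}. norm (f s - p s) < e)" if e: "0 < e" for e
  proof -
    obtain n where n: "\<forall>y\<in>{0..1}. norm (f (T * y) - (\<Sum>k\<le>n. Bernstein n k y *\<^sub>R f (T * (k / n)))) < e"
      using Bernstein_approximation[OF cf e] by blast
    let ?p = "\<lambda>s. \<Sum>k\<le>n. Bernstein n k (s / T) *\<^sub>R f (T * (k / n))"
    have "real_polynomial_function (\<lambda>s. s / T)"
      by (intro real_polynomial_function.intros(1) bounded_linear_divide)
    then have "real_polynomial_function (\<lambda>s. Bernstein n k (s / T))" for k
      unfolding Bernstein_def
      by (intro real_polynomial_function.intros(2-4) real_polynomial_function_power real_polynomial_function_diff)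
    then have "P ?p" by (intro sum poly)
    moreover have "norm (f s - ?p s) < e" if "s \<in> {0..T}" for s
      using n[rule_format, of "s / T"] that T by simp
    ultimately show ?thesis by blast
  qed
  then have "\<exists>p. \<forall>n. P (p n) \<and> (\<forall>s\<in>{0..T}. norm (f s - p n s) < inverse (Suc n))"
    by (intro choice allI) simp
  then obtain p where p: "\<And>n. P (p n)" "\<And>n s. s \<in> {0..T} \<Longrightarrow> norm (f s - p n s) < inverse (Suc n)"
    by blast
  have lim: "uniform_limit {0..T} p f sequentially"
  proof (rule uniform_limitI)
    fix e :: real assume "0 < e"
    then have "\<forall>\<^sub>F n in sequentially. inverse (real (Suc n)) < e"
      by (intro order_tendstoD[OF LIMSEQ_inverse_real_of_nat])
    then show "\<forall>\<^sub>F n in sequentially. \<forall>s\<in>{0..T}. dist (p n s) (f s) < e"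
    proof eventually_elim
      case (elim n)
      show ?case
        using less_trans[OF p(2) elim] by (simp add: dist_norm norm_minus_commute[of "p n _"])
    qed
  qed
  show ?thesis by (rule limit[OF p(1) lim])
qed

lemma frac_integral_monomial:
  assumes "0 \<le> a" "0 \<le> t"
  shows "frac_integral a (\<lambda>s. s ^ n *\<^sub>R v) t = frac_monomial (a + real n) t *\<^sub>R (fact n *\<^sub>R v)"
proof -
  have "frac_integral a (\<lambda>s. s ^ n *\<^sub>R v) t = frac_integral a (\<lambda>s. frac_monomial (real n) s *\<^sub>R (fact n *\<^sub>R v)) t"
    using assms by (intro frac_integral_cong) (simp_all add: power_eq_frac_monomial mult.commute)
  also have "\<dots> = frac_monomial (a + real n) t *\<^sub>R (fact n *\<^sub>R v)"
    using assms by (intro frac_integral_frac_monomial) auto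
  finally show ?thesis .
qed

lemma continuous_on_frac_integral:
  fixes f :: "real \<Rightarrow> 'a::banach"
  assumes a: "0 \<le> a" and T: "0 < T" and f: "continuous_on {0..T} f"
  shows "continuous_on {0..T} (frac_integral a f)"
proof -
  have "continuous_on {0..T} f \<and> continuous_on {0..T} (frac_integral a f)"
    using f T
  proof (induction rule: continuous_on_monomial_induct)
    case (monomial n v)
    have "continuous_on {0..T} (\<lambda>t. frac_monomial (a + real n) t *\<^sub>R (fact n *\<^sub>R v))"
      using a by (intro continuous_intros continuous_on_frac_monomial) auto
    then have "continuous_on {0..T} (frac_integral a (\<lambda>s. s ^ n *\<^sub>R v))"
      by (rule continuous_on_eq) (use a in \<open>simp add: frac_integral_monomial\<close>)
    then show ?case by (auto intro!: continuous_intros)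
  next
    case (add p q)
    then have "continuous_on {0..T} (\<lambda>t. frac_integral a p t + frac_integral a q t)"
      by (intro continuous_intros) auto
    then have "continuous_on {0..T} (frac_integral a (\<lambda>s. p s + q s))"
      by (rule continuous_on_eq)
        (use a add in \<open>auto intro!: frac_integral_add[symmetric] elim!: continuous_on_subset\<close>)
    then show ?case using add by (auto intro!: continuous_intros)
  next
    case (limit p g)
    have "uniform_limit {0..T} (\<lambda>n. frac_integral a (p n)) (frac_integral a g) sequentially"
      using limit a by (intro uniform_limit_frac_integral) auto
    then have "continuous_on {0..T} (frac_integral a g)"
      by (rule uniform_limit_theorem[rotated]) (use limit in auto)
    moreover have "continuous_on {0..T} g"
      by (rule uniform_limit_theorem[OF _ limit(2)]) (use limit in auto)
    ultimately show ?case by simp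
  qed
  then show ?thesis ..
qed

text \<open>
  On monomials both sides are \<open>t\<^bsup>a+b+n\<^esup>\<close> up to the same Gamma factor; both sides are additive and
  stable under uniform limits.
\<close>

lemma frac_integral_frac_integral:
  fixes f :: "real \<Rightarrow> 'a::banach"
  assumes a: "0 \<le> a" and b: "0 \<le> b" and T: "0 < T" and f: "continuous_on {0..T} f"
    and t: "t \<in> {0..T}"
  shows "frac_integral a (frac_integral b f) t = frac_integral (a + b) f t"
proof -
  have "continuous_on {0..T} f \<and> (\<forall>t\<in>{0..T}. frac_integral a (frac_integral b f) t = frac_integral (a + b) f t)"
    using f T
  proof (induction rule: continuous_on_monomial_induct)
    case (monomial n v)
    have "frac_integral a (frac_integral b (\<lambda>s. s ^ n *\<^sub>R v)) t
        = frac_integral (a + b) (\<lambda>s. s ^ n *\<^sub>R v) t" if t: "t \<in> {0..T}" for t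
    proof -
      have "frac_integral a (frac_integral b (\<lambda>s. s ^ n *\<^sub>R v)) t
          = frac_integral a (\<lambda>s. frac_monomial (b + real n) s *\<^sub>R (fact n *\<^sub>R v)) t"
        using b t by (intro frac_integral_cong) (simp_all add: frac_integral_monomial)
      also have "\<dots> = frac_monomial (a + (b + real n)) t *\<^sub>R (fact n *\<^sub>R v)"
        using a b t by (intro frac_integral_frac_monomial) auto
      finally show ?thesis
        using a b t by (simp add: frac_integral_monomial add.assoc)
    qed
    then show ?case by (auto intro!: continuous_intros)
  next
    case (add p q)
    have "frac_integral a (frac_integral b (\<lambda>s. p s + q s)) t
        = frac_integral (a + b) (\<lambda>s. p s + q s) t" if t: "t \<in> {0..T}" for t
    proof -
      have sub: "continuous_on {0..s} p" "continuous_on {0..s} q"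
        "continuous_on {0..s} (frac_integral b p)" "continuous_on {0..s} (frac_integral b q)"
        if "s \<in> {0..T}" for s
        using add that b T by (auto intro: continuous_on_subset continuous_on_frac_integral)
      have "frac_integral a (frac_integral b (\<lambda>s. p s + q s)) t
          = frac_integral a (\<lambda>s. frac_integral b p s + frac_integral b q s) t"
        using b t sub by (intro frac_integral_cong) (simp_all add: frac_integral_add)
      also have "\<dots> = frac_integral a (frac_integral b p) t + frac_integral a (frac_integral b q) t"
        using a t sub[OF t] by (intro frac_integral_add) auto
      also have "\<dots> = frac_integral (a + b) p t + frac_integral (a + b) q t"
        using add t by simp
      also have "\<dots> = frac_integral (a + b) (\<lambda>s. p s + q s) t"
        using a b t sub[OF t] by (intro frac_integral_add[symmetric]) auto
      finally show ?thesis .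
    qed
    then show ?case using add by (auto intro!: continuous_intros)
  next
    case (limit p g)
    have cp: "continuous_on {0..T} (p n)" for n using limit by simp
    have "uniform_limit {0..T} (\<lambda>n. frac_integral a (frac_integral b (p n))) (frac_integral a (frac_integral b g)) sequentially"
      using a b T cp limit(2) by (intro uniform_limit_frac_integral continuous_on_frac_integral)
    moreover have "uniform_limit {0..T} (\<lambda>n. frac_integral (a + b) (p n)) (frac_integral (a + b) g) sequentially"
      using a b cp limit(2) by (intro uniform_limit_frac_integral) auto
    ultimately have "frac_integral a (frac_integral b g) t = frac_integral (a + b) g t" if "t \<in> {0..T}" for t
      using that limit(1) by (auto dest!: tendsto_uniform_limitI intro: LIMSEQ_unique)
    moreover have "continuous_on {0..T} g"
      by (rule uniform_limit_theorem[OF _ limit(2)]) (use cp in auto)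
    ultimately show ?case by simp
  qed
  then show ?thesis using t by simp
qed

section \<open>Absolute convergence of the double series\<close>

text \<open>
  By the binomial theorem the terms with \<open>k + m = n\<close> contribute at most \<open>C (a + b)\<^sup>n\<close>, a convergent
  geometric series. So the family is absolutely summable over all pairs, and its sum can be
  computed by rows, which is the iterated series, or along the triangles \<open>k + m < N\<close>.
\<close>

lemma double_series_binomial_majorant:
  fixes c :: "nat \<Rightarrow> nat \<Rightarrow> 'b::banach"
  assumes C: "0 \<le> C" and a: "0 \<le> a" and b: "0 \<le> b" and ab: "a + b < 1"
    and le: "\<And>k m. norm (c k m) \<le> C * (real ((k + m) choose m) * (a ^ k * b ^ m))"
  shows "iterated_summable c"
    and "(\<lambda>n. \<Sum>k\<le>n. c k (n - k)) sums (\<Sum>k. \<Sum>m. c k m)"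
    and "norm (\<Sum>k\<le>n. c k (n - k)) \<le> C * (a + b) ^ n"
proof -
  have diag: "(\<Sum>k\<le>n. norm (c k (n - k))) \<le> C * (a + b) ^ n" for n
  proof -
    have "(\<Sum>k\<le>n. norm (c k (n - k))) \<le> (\<Sum>k\<le>n. C * (real (n choose k) * a ^ k * b ^ (n - k)))"
    proof (rule sum_mono)
      fix k assume "k \<in> {..n}"
      then show "norm (c k (n - k)) \<le> C * (real (n choose k) * a ^ k * b ^ (n - k))"
        using le[of k "n - k"] by (simp add: binomial_symmetric[of k n] mult.assoc)
    qed
    also have "\<dots> = C * (a + b) ^ n"
      by (simp add: binomial_ring sum_distrib_left)
    finally show ?thesis .
  qed
  show "norm (\<Sum>k\<le>n. c k (n - k)) \<le> C * (a + b) ^ n"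
    using norm_sum diag by (rule order_trans)
  define D where "D N = {(k, m). k + m < (N::nat)}" for N
  have finD: "finite (D N)" for N
    by (rule finite_subset[of _ "{..<N} \<times> {..<N}"]) (auto simp: D_def)
  have D: "X \<subseteq> D N" if "finite X" "Suc (\<Sum>x\<in>X. fst x + snd x) \<le> N" for X N
  proof
    fix x assume "x \<in> X"
    then have "fst x + snd x \<le> (\<Sum>x\<in>X. fst x + snd x)"
      using that(1) by (intro member_le_sum) auto
    then show "x \<in> D N" using that(2) by (auto simp: D_def case_prod_beta)
  qed
  have sumD: "(\<Sum>(k,m)\<in>D N. f k m) = (\<Sum>n<N. \<Sum>k\<le>n. f k (n - k))" for N and f :: "nat \<Rightarrow> nat \<Rightarrow> 'c::comm_monoid_add"
    unfolding D_def by (rule sum.triangle_reindex)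
  have "(\<lambda>(k,m). c k m) abs_summable_on UNIV"
  proof (rule nonneg_bdd_above_summable_on)
    show "bdd_above (sum (\<lambda>x. norm (case x of (k, m) \<Rightarrow> c k m)) ` {F. F \<subseteq> UNIV \<and> finite F})"
    proof (rule bdd_aboveI2)
      fix F :: "(nat \<times> nat) set" assume "F \<in> {F. F \<subseteq> UNIV \<and> finite F}"
      then have "finite F" by simp
      define N where "N = Suc (\<Sum>x\<in>F. fst x + snd x)"
      have "(\<Sum>x\<in>F. norm (case x of (k, m) \<Rightarrow> c k m)) \<le> (\<Sum>(k, m)\<in>D N. norm (c k m))"
        using D[OF \<open>finite F\<close>, of N] by (simp add: case_prod_beta N_def sum_mono2 finD)
      also have "\<dots> \<le> (\<Sum>n<N. C * (a + b) ^ n)"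
        unfolding sumD by (intro sum_mono diag)
      also have "\<dots> = C * (\<Sum>n<N. (a + b) ^ n)"
        by (simp add: sum_distrib_left)
      also have "\<dots> \<le> C * (\<Sum>n. (a + b) ^ n)"
        using a b ab C by (intro mult_left_mono sum_le_suminf summable_geometric) auto
      finally show "(\<Sum>x\<in>F. norm (case x of (k, m) \<Rightarrow> c k m)) \<le> C * (\<Sum>n. (a + b) ^ n)" .
    qed
  qed simp
  then have summable: "(\<lambda>(k,m). c k m) summable_on UNIV \<times> UNIV"
    by (simp add: abs_summable_summable)
  have inner: "(c k) summable_on UNIV" for k
  proof -
    have "(\<lambda>(k,m). c k m) summable_on Pair k ` UNIV"
      by (rule summable_on_subset_banach[OF summable]) auto
    then have "((\<lambda>(k,m). c k m) \<circ> Pair k) summable_on UNIV"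
      by (simp add: summable_on_reindex inj_on_def)
    then show ?thesis by (simp add: o_def)
  qed
  then have suminf_inner: "(\<Sum>m. c k m) = infsum (c k) UNIV" and "summable (c k)" for k
    using has_sum_imp_sums[OF has_sum_infsum[OF inner[of k]]] by (auto simp: sums_iff)
  moreover have outer: "(\<lambda>k. infsum (c k) UNIV) summable_on UNIV"
    using summable_on_Sigma_banach[OF summable] by simp
  moreover have outer_sums: "(\<lambda>k. infsum (c k) UNIV) sums infsum (\<lambda>(k,m). c k m) (UNIV \<times> UNIV)"
    using has_sum_imp_sums[OF has_sum_infsum[OF outer]] infsum_Sigma'_banach[OF summable] by simp
  ultimately show "iterated_summable c"
    by (simp add: iterated_summable_def sums_iff)
  have "filterlim D (finite_subsets_at_top (UNIV \<times> UNIV)) sequentially"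
    unfolding filterlim_finite_subsets_at_top eventually_sequentially using D finD by simp blast
  then have "(\<lambda>N. \<Sum>(k,m)\<in>D N. c k m) \<longlonglongrightarrow> infsum (\<lambda>(k,m). c k m) (UNIV \<times> UNIV)"
    using has_sum_infsum[OF summable] unfolding has_sum_def by (rule filterlim_compose[rotated])
  then show "(\<lambda>n. \<Sum>k\<le>n. c k (n - k)) sums (\<Sum>k. \<Sum>m. c k m)"
    using outer_sums by (simp add: sums_def[of "\<lambda>n. \<Sum>k\<le>n. c k (n - k)"] sumD suminf_inner sums_unique[symmetric])
qed

text \<open>
  Only the part of Euler's integral over \<open>{R..R+1}\<close> is kept. As \<open>R\<close> is arbitrary, \<open>\<Gamma>\<close> dominates every
  exponential.
\<close>

lemma Gamma_ge_powr:
  fixes y R :: real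
  assumes y: "1 \<le> y" and R: "0 < R"
  shows "R powr (y - 1) * exp (- (R + 1)) \<le> Gamma y"
proof -
  let ?f = "\<lambda>t. t powr (y - 1) / exp t"
  have G: "(?f has_integral Gamma y) {0..}"
    using y by (intro Gamma_integral_real) simp
  have f: "?f integrable_on {R..R+1}"
    using R by (intro integrable_continuous_real continuous_intros) auto
  have "R powr (y - 1) * exp (- (R + 1)) \<le> ?f t" if "t \<in> {R..R+1}" for t
  proof -
    have "R powr (y - 1) * exp (- (R + 1)) \<le> t powr (y - 1) * exp (- t)"
      using that y R by (intro mult_mono powr_mono2) auto
    then show ?thesis by (simp add: exp_minus divide_inverse)
  qed
  then have "integral {R..R+1} (\<lambda>_. R powr (y - 1) * exp (- (R + 1))) \<le> integral {R..R+1} ?f"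
    using f by (intro integral_le) auto
  also have "\<dots> \<le> integral {0..} ?f"
    using R f G by (intro integral_subset_le) (auto simp: has_integral_iff)
  also have "\<dots> = Gamma y" using G by (rule integral_unique)
  finally show ?thesis by simp
qed

lemma frac_monomial_le:
  assumes e: "0 \<le> e" and t: "0 \<le> t" "t \<le> T" and T: "0 < T" and R: "0 < R"
  shows "frac_monomial e t \<le> exp (R + 1) * (T / R) powr e"
proof (cases "e = 0")
  case True
  then show ?thesis using T R by (simp add: frac_monomial_def)
next
  case False
  have "R powr e * exp (- (R + 1)) \<le> Gamma (e + 1)"
    using Gamma_ge_powr[of "e + 1" R] e R by simp
  then have "t powr e / Gamma (e + 1) \<le> T powr e / (R powr e * exp (- (R + 1)))"
    using t e R by (intro frac_le powr_mono2) auto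
  also have "\<dots> = exp (R + 1) * (T / R) powr e"
    unfolding exp_minus powr_divide
    by (simp add: field_simps)
  finally show ?thesis using False by (simp add: frac_monomial_def)
qed

text \<open>
  Since \<open>\<gamma> \<le> \<alpha>\<close>, the exponent is at least \<open>(k + m) \<gamma>\<close>. With \<open>q = 2 (a + b) + 1\<close>, choosing \<open>R\<close> such
  that \<open>(T/R)\<^sup>\<gamma> = 1/q\<close> makes the lower bound for \<open>\<Gamma>\<close> provide the factor \<open>q\<^bsup>-(k+m)\<^esup>\<close>, and
  \<open>a/q + b/q\<close> is below \<open>1/2\<close>. The constants depend neither on \<open>t\<close> nor on the shift \<open>p\<close>.
\<close>

lemma frac_monomial_geometric_bound:
  fixes \<alpha> \<gamma> T a b :: real
  assumes \<gamma>: "0 < \<gamma>" "\<gamma> \<le> \<alpha>" and T: "0 < T" and a: "0 \<le> a" and b: "0 \<le> b"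
  obtains C a' b' where "0 \<le> C" "0 \<le> a'" "0 \<le> b'" "a' + b' < 1"
    "\<And>k m p t. 0 \<le> p \<Longrightarrow> 0 \<le> t \<Longrightarrow> t \<le> T \<Longrightarrow>
      frac_monomial (real k * \<gamma> + real m * \<alpha> + p) t * (a ^ k * b ^ m) \<le> C * (a' ^ k * b' ^ m)"
proof -
  define q where "q = 2 * (a + b) + 1"
  have q: "1 \<le> q" using a b by (simp add: q_def)
  define R where "R = T * q powr (1 / \<gamma>)"
  have R: "0 < R" using T q by (simp add: R_def)
  have TR: "T / R = q powr (- (1 / \<gamma>))"
    using T q by (simp add: R_def powr_minus field_simps)
  show thesis
  proof (rule that[of "exp (R + 1)" "a / q" "b / q"])
    show "a / q + b / q < 1"
      using a b q by (simp add: q_def add_divide_distrib[symmetric] divide_less_eq)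
    fix k m :: nat and p t :: real
    assume p: "0 \<le> p" and t: "0 \<le> t" "t \<le> T"
    let ?e = "real k * \<gamma> + real m * \<alpha> + p"
    have e: "real (k + m) * \<gamma> \<le> ?e"
      using \<gamma> p mult_left_mono[of \<gamma> \<alpha> "real m"] by (simp add: distrib_right)
    have e0: "0 \<le> ?e" by (rule order_trans[OF _ e]) (use \<gamma> in simp)
    have "(T / R) powr ?e = q powr (- (?e / \<gamma>))"
      unfolding TR by (simp add: powr_powr)
    also have "\<dots> \<le> q powr (- real (k + m))"
    proof (intro powr_mono)
      have "real (k + m) \<le> ?e / \<gamma>" using e \<gamma> by (simp only: pos_le_divide_eq)
      then show "- (?e / \<gamma>) \<le> - real (k + m)" by linarith
    qed (rule q)
    also have "\<dots> = 1 / q ^ (k + m)"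
      using q by (simp only: powr_minus powr_realpow[of q "k + m"] divide_inverse mult_1)
    finally have "(T / R) powr ?e \<le> 1 / q ^ (k + m)" .
    then have "exp (R + 1) * (T / R) powr ?e \<le> exp (R + 1) * (1 / q ^ (k + m))"
      by (rule mult_left_mono) simp
    with frac_monomial_le[OF e0 t T R] have "frac_monomial ?e t \<le> exp (R + 1) * (1 / q ^ (k + m))"
      by (rule order_trans)
    then have "frac_monomial ?e t * (a ^ k * b ^ m) \<le> exp (R + 1) * (1 / q ^ (k + m)) * (a ^ k * b ^ m)"
      by (rule mult_right_mono) (simp add: a b)
    also have "\<dots> = exp (R + 1) * ((a / q) ^ k * (b / q) ^ m)"
      by (simp add: power_divide power_add)
    finally show "frac_monomial ?e t * (a ^ k * b ^ m) \<le> exp (R + 1) * ((a / q) ^ k * (b / q) ^ m)" .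
  qed (use a b q in auto)
qed

subsection \<open>The operator coefficients\<close>

lemma blinfun_power_0 [simp]: "blinfun_power A 0 = id_blinfun"
  by (simp add: blinfun_power_def)

lemma blinfun_power_Suc [simp]: "blinfun_power A (Suc k) = A o\<^sub>L blinfun_power A k"
  by (simp add: blinfun_power_def)

lemma norm_blinfun_power: "norm (blinfun_power A k) \<le> norm A ^ k"
proof (induction k)
  case (Suc k)
  then show ?case
    using norm_blinfun_compose[of A "blinfun_power A k"] mult_left_mono[OF Suc, of "norm A"] by simp
qed (simp add: norm_blinfun_id_le)

lemma blinfun_power_commute:
  fixes A B :: "'a::real_normed_vector \<Rightarrow>\<^sub>L 'a"
  assumes "\<And>v. A (B v) = B (A v)"
  shows "blinfun_power B m (A v) = A (blinfun_power B m v)"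
  by (induction m) (simp_all add: assms)

text \<open>
  In each of the three double series \<open>q = p + 1\<close> and the exponent is positive, so the scalar
  factor is a normalised power.
\<close>

lemma ml_term_eq_frac_monomial:
  assumes "0 < real k * (\<alpha> - \<beta>) + real m * \<alpha> + p" and "q = p + 1"
  shows "ml_term A B \<alpha> \<beta> j p q t k m =
    (real ((k + m) choose m) * frac_monomial (real k * (\<alpha> - \<beta>) + real m * \<alpha> + p) t)
      *\<^sub>R (blinfun_power A k o\<^sub>L blinfun_power B (m + j))"
  using assms by (simp add: ml_term_def frac_monomial_def add.assoc)

lemma ml_term_binomial_majorant:
  fixes A B :: "'a::banach \<Rightarrow>\<^sub>L 'a"
  assumes \<beta>: "0 \<le> \<beta>" "\<beta> < \<alpha>" and T: "0 < T" and p: "0 < p" "q = p + 1"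
  obtains C a b where "0 \<le> C" "0 \<le> a" "0 \<le> b" "a + b < 1"
    "\<And>k m t. 0 \<le> t \<Longrightarrow> t \<le> T \<Longrightarrow>
      norm (ml_term A B \<alpha> \<beta> j p q t k m) \<le> C * (real ((k + m) choose m) * (a ^ k * b ^ m))"
proof -
  obtain C a b where C: "0 \<le> C" "0 \<le> a" "0 \<le> b" "a + b < 1"
    and le: "\<And>k m p t. 0 \<le> p \<Longrightarrow> 0 \<le> t \<Longrightarrow> t \<le> T \<Longrightarrow>
      frac_monomial (real k * (\<alpha> - \<beta>) + real m * \<alpha> + p) t * (norm A ^ k * norm B ^ m) \<le> C * (a ^ k * b ^ m)"
    by (rule frac_monomial_geometric_bound[of "\<alpha> - \<beta>" \<alpha> T "norm A" "norm B"])
      (use \<beta> T in simp_all)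
  show thesis
  proof (rule that[of "C * norm B ^ j" a b])
    fix k m t assume t: "0 \<le> (t::real)" "t \<le> T"
    let ?e = "real k * (\<alpha> - \<beta>) + real m * \<alpha> + p"
    have e: "0 < ?e" using \<beta> p by (intro add_nonneg_pos add_nonneg_nonneg) auto
    have AB: "norm (blinfun_power A k o\<^sub>L blinfun_power B (m + j)) \<le> norm A ^ k * norm B ^ (m + j)"
      by (rule order_trans[OF norm_blinfun_compose]) (intro mult_mono norm_blinfun_power; simp)
    have "norm (ml_term A B \<alpha> \<beta> j p q t k m)
        = (real ((k + m) choose m) * frac_monomial ?e t) * norm (blinfun_power A k o\<^sub>L blinfun_power B (m + j))"
      unfolding ml_term_eq_frac_monomial[OF e p(2)] using e frac_monomial_nonneg[of ?e t]
      by (simp add: abs_mult)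
    also have "\<dots> \<le> (real ((k + m) choose m) * frac_monomial ?e t) * (norm A ^ k * norm B ^ (m + j))"
      using e by (intro mult_left_mono[OF AB] mult_nonneg_nonneg frac_monomial_nonneg) auto
    also have "\<dots> = (real ((k + m) choose m) * norm B ^ j) * (frac_monomial ?e t * (norm A ^ k * norm B ^ m))"
      by (simp add: power_add ac_simps)
    also have "\<dots> \<le> (real ((k + m) choose m) * norm B ^ j) * (C * (a ^ k * b ^ m))"
      using p t by (intro mult_left_mono le) auto
    finally show "norm (ml_term A B \<alpha> \<beta> j p q t k m)
        \<le> C * norm B ^ j * (real ((k + m) choose m) * (a ^ k * b ^ m))"
      by (simp add: ac_simps)
  qed (use C in auto)
qed

section \<open>The Neumann series of the Volterra equation\<close>

text \<open>
  Pascal's rule \<open>binom(n+1,k+1) = binom(n,k) + binom(n,k+1)\<close>, summed against an arbitrary array.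
\<close>

lemma sum_binomial_Suc:
  fixes T :: "nat \<Rightarrow> nat \<Rightarrow> 'v::real_vector"
  shows "(\<Sum>k\<le>n. real (n choose k) *\<^sub>R (T (Suc k) (n - k) + T k (Suc (n - k))))
    = (\<Sum>k\<le>Suc n. real (Suc n choose k) *\<^sub>R T k (Suc n - k))"
proof -
  have "(\<Sum>k\<le>n. real (n choose k) *\<^sub>R T k (Suc (n - k))) = (\<Sum>k\<le>n. real (n choose k) *\<^sub>R T k (Suc n - k))"
    by (intro sum.cong) (auto simp: Suc_diff_le)
  also have "\<dots> = (\<Sum>k\<le>Suc n. real (n choose k) *\<^sub>R T k (Suc n - k))"
    by simp
  also have "\<dots> = T 0 (Suc n) + (\<Sum>k\<le>n. real (n choose Suc k) *\<^sub>R T (Suc k) (n - k))"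
    by (subst sum.atMost_Suc_shift) simp
  finally have shift: "(\<Sum>k\<le>n. real (n choose k) *\<^sub>R T k (Suc (n - k)))
      = T 0 (Suc n) + (\<Sum>k\<le>n. real (n choose Suc k) *\<^sub>R T (Suc k) (n - k))" .
  have "(\<Sum>k\<le>Suc n. real (Suc n choose k) *\<^sub>R T k (Suc n - k))
      = T 0 (Suc n) + (\<Sum>k\<le>n. real (Suc n choose Suc k) *\<^sub>R T (Suc k) (n - k))"
    by (subst sum.atMost_Suc_shift) simp
  also have "\<dots> = (\<Sum>k\<le>n. real (n choose k) *\<^sub>R T (Suc k) (n - k))
      + (\<Sum>k\<le>n. real (n choose k) *\<^sub>R T k (Suc (n - k)))"
    unfolding shift by (simp add: scaleR_add_left sum.distrib)
  finally show ?thesis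
    by (simp add: scaleR_add_right sum.distrib)
qed

text \<open>The binomial expansion of \<open>(A J\<^sup>\<gamma> + B J\<^sup>\<alpha>)\<^sup>n u\<close>.\<close>

definition neumann_term ::
    "('a::banach \<Rightarrow>\<^sub>L 'a) \<Rightarrow> ('a \<Rightarrow>\<^sub>L 'a) \<Rightarrow> real \<Rightarrow> real \<Rightarrow> nat \<Rightarrow> (real \<Rightarrow> 'a) \<Rightarrow> real \<Rightarrow> 'a" where
  "neumann_term A B \<gamma> \<alpha> n u t =
    (\<Sum>k\<le>n. real (n choose k) *\<^sub>R blinfun_power A k (blinfun_power B (n - k)
      (frac_integral (real k * \<gamma> + real (n - k) * \<alpha>) u t)))"

text \<open>
  Moving \<open>A\<close> and \<open>B\<close> past the powers and merging the fractional integrals by the semigroup law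
  turns each summand into its neighbours at \<open>(k+1, m)\<close> and \<open>(k, m+1)\<close>; Pascal's rule regroups them.
\<close>

lemma neumann_term_Suc:
  fixes A B :: "'a::banach \<Rightarrow>\<^sub>L 'a" and u :: "real \<Rightarrow> 'a"
  assumes AB: "\<And>v. A (B v) = B (A v)" and \<gamma>: "0 \<le> \<gamma>" and \<alpha>: "0 \<le> \<alpha>" and T: "0 < T"
    and u: "continuous_on {0..T} u" and t: "t \<in> {0..T}"
  shows "neumann_term A B \<gamma> \<alpha> n (\<lambda>s. A (frac_integral \<gamma> u s) + B (frac_integral \<alpha> u s)) t
    = neumann_term A B \<gamma> \<alpha> (Suc n) u t"
proof -
  let ?T = "\<lambda>k m. blinfun_power A k (blinfun_power B m (frac_integral (real k * \<gamma> + real m * \<alpha>) u t))"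
  have "blinfun_power A k (blinfun_power B m (frac_integral (real k * \<gamma> + real m * \<alpha>)
        (\<lambda>s. A (frac_integral \<gamma> u s) + B (frac_integral \<alpha> u s)) t))
      = ?T (Suc k) m + ?T k (Suc m)" for k m
  proof -
    define e where "e = real k * \<gamma> + real m * \<alpha>"
    have e: "0 \<le> e" using \<gamma> \<alpha> by (simp add: e_def)
    have c: "continuous_on {0..t} (frac_integral c u)" if "0 \<le> c" for c
      using continuous_on_frac_integral[OF that T u] t by (auto elim: continuous_on_subset)
    have "frac_integral e (\<lambda>s. A (frac_integral \<gamma> u s) + B (frac_integral \<alpha> u s)) t
        = frac_integral e (\<lambda>s. A (frac_integral \<gamma> u s)) t + frac_integral e (\<lambda>s. B (frac_integral \<alpha> u s)) t"
      using e t \<gamma> \<alpha> by (intro frac_integral_add continuous_intros c) auto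
    also have "\<dots> = A (frac_integral e (frac_integral \<gamma> u) t) + B (frac_integral e (frac_integral \<alpha> u) t)"
      using e t \<gamma> \<alpha> by (simp add: frac_integral_blinfun c)
    also have "\<dots> = A (frac_integral (e + \<gamma>) u t) + B (frac_integral (e + \<alpha>) u t)"
      using frac_integral_frac_integral[OF e \<gamma> T u t] frac_integral_frac_integral[OF e \<alpha> T u t] by simp
    finally have "frac_integral e (\<lambda>s. A (frac_integral \<gamma> u s) + B (frac_integral \<alpha> u s)) t
      = A (frac_integral (e + \<gamma>) u t) + B (frac_integral (e + \<alpha>) u t)" .
    moreover have "real (Suc k) * \<gamma> + real m * \<alpha> = e + \<gamma>" "real k * \<gamma> + real (Suc m) * \<alpha> = e + \<alpha>"
      by (simp_all add: e_def algebra_simps)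
    moreover have "A (blinfun_power A k v) = blinfun_power A k (A v)" for v
      by (rule blinfun_power_commute[symmetric]) simp
    moreover have "B (blinfun_power B m v) = blinfun_power B m (B v)" for v
      by (rule blinfun_power_commute[symmetric]) simp
    ultimately show ?thesis
      by (simp add: e_def[symmetric] blinfun.add_right blinfun_power_commute[OF AB])
  qed
  then show ?thesis
    unfolding neumann_term_def
    using sum_binomial_Suc[of n ?T] by (simp only:)
qed

lemma neumann_term_cong:
  assumes "0 \<le> t" "\<And>s. s \<in> {0..t} \<Longrightarrow> f s = g s"
  shows "neumann_term A B \<gamma> \<alpha> n f t = neumann_term A B \<gamma> \<alpha> n g t"
  unfolding neumann_term_def using frac_integral_cong[of t f g, OF assms] by simp

lemma neumann_term_add:
  assumes "0 \<le> \<gamma>" "0 \<le> \<alpha>" "0 \<le> t" "continuous_on {0..t} f" "continuous_on {0..t} g"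
  shows "neumann_term A B \<gamma> \<alpha> n (\<lambda>s. f s + g s) t
    = neumann_term A B \<gamma> \<alpha> n f t + neumann_term A B \<gamma> \<alpha> n g t"
  unfolding neumann_term_def using assms
  by (simp add: frac_integral_add blinfun.add_right scaleR_add_right sum.distrib)

lemma norm_neumann_term_tendsto_0:
  fixes A B :: "'a::banach \<Rightarrow>\<^sub>L 'a"
  assumes \<gamma>: "0 < \<gamma>" "\<gamma> \<le> \<alpha>" and t: "0 < t" and u: "continuous_on {0..t} u"
  shows "(\<lambda>n. neumann_term A B \<gamma> \<alpha> n u t) \<longlonglongrightarrow> 0"
proof -
  obtain C a b where C: "0 \<le> C" "0 \<le> a" "0 \<le> b" "a + b < 1"
    and le: "\<And>k m p s. 0 \<le> p \<Longrightarrow> 0 \<le> s \<Longrightarrow> s \<le> t \<Longrightarrow>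
      frac_monomial (real k * \<gamma> + real m * \<alpha> + p) s * (norm A ^ k * norm B ^ m) \<le> C * (a ^ k * b ^ m)"
    by (rule frac_monomial_geometric_bound[OF \<gamma> t norm_ge_zero norm_ge_zero, of A B]) blast
  have "bounded (u ` {0..t})"
    by (intro compact_imp_bounded compact_continuous_image u compact_Icc)
  then obtain M where M: "0 < M" "\<And>s. s \<in> {0..t} \<Longrightarrow> norm (u s) \<le> M"
    unfolding bounded_pos by blast
  have bound: "norm (blinfun_power A k (blinfun_power B m (frac_integral (real k * \<gamma> + real m * \<alpha>) u t)))
      \<le> M * C * (a ^ k * b ^ m)" for k m
  proof -
    let ?e = "real k * \<gamma> + real m * \<alpha>"
    let ?v = "frac_integral ?e u t"
    have "norm (blinfun_power A k (blinfun_power B m ?v)) \<le> norm A ^ k * (norm B ^ m * norm ?v)"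
      by (intro order_trans[OF norm_blinfun] mult_mono norm_blinfun_power) auto
    also have "\<dots> \<le> norm A ^ k * (norm B ^ m * (frac_monomial ?e t * M))"
      using \<gamma> t u M by (intro mult_left_mono norm_frac_integral_le) auto
    also have "norm A ^ k * (norm B ^ m * (frac_monomial ?e t * M))
        = M * (frac_monomial (?e + 0) t * (norm A ^ k * norm B ^ m))"
      by (simp add: ac_simps)
    also have "\<dots> \<le> M * (C * (a ^ k * b ^ m))"
      using M t by (intro mult_left_mono le) auto
    finally show ?thesis by (simp add: ac_simps)
  qed
  have le: "norm (neumann_term A B \<gamma> \<alpha> n u t) \<le> M * C * (a + b) ^ n" for n
  proof -
    have "norm (neumann_term A B \<gamma> \<alpha> n u t) \<le> (\<Sum>k\<le>n. real (n choose k) * (M * C * (a ^ k * b ^ (n - k))))"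
      unfolding neumann_term_def
      by (intro sum_norm_le) (simp only: norm_scaleR real_norm_def abs_of_nat mult_left_mono[OF bound of_nat_0_le_iff])
    also have "\<dots> = M * C * (a + b) ^ n"
      by (simp add: binomial_ring sum_distrib_left ac_simps)
    finally show ?thesis .
  qed
  have lim: "(\<lambda>n. M * C * (a + b) ^ n) \<longlonglongrightarrow> 0"
    using tendsto_mult_left[OF LIMSEQ_realpow_zero[of "a + b"], of "M * C"] C by simp
  show ?thesis
    by (rule Lim_null_comparison[OF always_eventually lim]) (rule allI, rule le)
qed

text \<open>
  Substituting the equation into itself \<open>N\<close> times leaves the \<open>N\<close>-th iterate of \<open>z\<close> as the remainder.
  As this is derived for any continuous solution, it includes uniqueness.
\<close>

lemma volterra_neumann_series:
  fixes A B :: "'a::banach \<Rightarrow>\<^sub>L 'a"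
  assumes AB: "\<And>v. A (B v) = B (A v)" and \<gamma>: "0 < \<gamma>" "\<gamma> \<le> \<alpha>" and T: "0 < T"
    and z: "continuous_on {0..T} z" and f: "continuous_on {0..T} f"
    and eq: "\<And>t. t \<in> {0..T} \<Longrightarrow> z t = f t + (A (frac_integral \<gamma> z t) + B (frac_integral \<alpha> z t))"
    and t: "0 < t" "t \<le> T"
  shows "(\<lambda>n. neumann_term A B \<gamma> \<alpha> n f t) sums z t"
proof -
  let ?N = "neumann_term A B \<gamma> \<alpha>"
  let ?L = "\<lambda>s. A (frac_integral \<gamma> z s) + B (frac_integral \<alpha> z s)"
  have zt: "continuous_on {0..t} z" and ft: "continuous_on {0..t} f"
    using t by (auto intro: continuous_on_subset[OF z] continuous_on_subset[OF f])
  have L: "continuous_on {0..t} ?L"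
    using \<gamma> t by (intro blinfun.continuous_on continuous_on_add continuous_on_const
        continuous_on_subset[OF continuous_on_frac_integral[OF _ T z]]) auto
  have step: "?N n z t = ?N n f t + ?N (Suc n) z t" for n
  proof -
    have "?N n z t = ?N n (\<lambda>s. f s + ?L s) t"
      using t eq by (intro neumann_term_cong) auto
    also have "\<dots> = ?N n f t + ?N n ?L t"
      using \<gamma> t by (intro neumann_term_add ft L) auto
    also have "?N n ?L t = ?N (Suc n) z t"
      by (rule neumann_term_Suc[OF AB _ _ T z]) (use \<gamma> t in auto)
    finally show ?thesis .
  qed
  have "?N 0 z t = z t"
    by (simp add: neumann_term_def frac_integral_def)
  moreover have "?N 0 z t = (\<Sum>n<N. ?N n f t) + ?N N z t" for N
    by (induction N) (simp_all add: step[symmetric])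
  ultimately have "(\<Sum>n<N. ?N n f t) = z t - ?N N z t" for N
    by (metis add_diff_cancel_right')
  then show ?thesis
    unfolding sums_def using tendsto_diff[OF tendsto_const norm_neumann_term_tendsto_0[OF \<gamma> t(1) zt]]
    by simp
qed

section \<open>From the Cauchy problem to the representation formula\<close>

text \<open>
  The two integral identities are the fundamental theorem of calculus with one-sided derivatives
  at the end points, written with fractional integrals of order 1.
\<close>

lemma Ck_on_2D:
  fixes x :: "real \<Rightarrow> 'a::banach"
  assumes T: "0 < T" and C2: "Ck_on 2 {0..T} x"
  defines "w \<equiv> nth_vector_derivative {0..T} 1 x" and "y \<equiv> nth_vector_derivative {0..T} 2 x"
  shows "continuous_on {0..T} x" "continuous_on {0..T} w" "continuous_on {0..T} y"
    and "t \<in> {0..T} \<Longrightarrow> x t = x 0 + frac_integral 1 w t"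
    and "t \<in> {0..T} \<Longrightarrow> w t = w 0 + frac_integral 1 y t"
proof -
  have w: "w = (\<lambda>t. vector_derivative x (at t within {0..T}))"
    by (simp add: w_def nth_vector_derivative_def)
  have y: "y = (\<lambda>t. vector_derivative w (at t within {0..T}))"
    by (simp add: y_def w nth_vector_derivative_def eval_nat_numeral)
  have diff: "nth_vector_derivative {0..T} i x differentiable (at t within {0..T})"
    if "i < 2" "t \<in> {0..T}" for i t
    using C2 that unfolding Ck_on_def by blast
  have x': "(x has_vector_derivative w t) (at t within {0..T})" if "t \<in> {0..T}" for t
    using diff[of 0 t] that unfolding w vector_derivative_works by (simp add: nth_vector_derivative_def)
  have w': "(w has_vector_derivative y t) (at t within {0..T})" if "t \<in> {0..T}" for t
    using diff[of 1 t] that unfolding y vector_derivative_works[symmetric] by (simp add: w_def)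
  show "continuous_on {0..T} x" "continuous_on {0..T} w"
    unfolding continuous_on_eq_continuous_within
    using has_vector_derivative_continuous[OF x'] has_vector_derivative_continuous[OF w'] by blast+
  show "continuous_on {0..T} y"
    using C2 by (simp add: Ck_on_def y_def)
  have J1: "frac_integral 1 f t = h t - h 0"
    if h: "\<And>t. t \<in> {0..T} \<Longrightarrow> (h has_vector_derivative f t) (at t within {0..T})" and t: "t \<in> {0..T}"
    for f h :: "real \<Rightarrow> 'a" and t
  proof -
    have "(f has_integral (h t - h 0)) {0..t}"
      using t by (intro fundamental_theorem_of_calculus has_vector_derivative_within_subset[OF h]) auto
    \<comment> \<open>At \<open>s = t\<close> the kernel is \<open>0 powr 0 = 0\<close> instead of 1; a single point does not matter.\<close>
    then have "((\<lambda>s. ((t - s) powr (1 - 1) / Gamma 1) *\<^sub>R f s) has_integral (h t - h 0)) {0..t}"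
      by (rule has_integral_spike[OF negligible_sing[of t], rotated]) auto
    then show ?thesis by (simp add: frac_integral_def integral_unique)
  qed
  show "t \<in> {0..T} \<Longrightarrow> x t = x 0 + frac_integral 1 w t"
    using J1[OF x'] by simp
  show "t \<in> {0..T} \<Longrightarrow> w t = w 0 + frac_integral 1 y t"
    using J1[OF w'] by simp
qed

text \<open>
  The convention that \<open>J\<^sup>0\<close> is the identity absorbs the separate case of integer order.
\<close>

lemma caputo_derivative_eq_frac_integral:
  fixes x :: "real \<Rightarrow> 'a::banach"
  assumes \<nu>: "real n - 1 < \<nu>" "\<nu> \<le> real n" and t: "0 \<le> t" "t \<le> T"
    and x: "continuous_on {0..T} (nth_vector_derivative {0..T} n x)"
  shows "caputo_derivative T \<nu> x t = frac_integral (real n - \<nu>) (nth_vector_derivative {0..T} n x) t"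
proof -
  let ?f = "nth_vector_derivative {0..T} n x"
  have n: "nat \<lceil>\<nu>\<rceil> = n"
  proof -
    have "\<lceil>\<nu>\<rceil> = int n" using \<nu> by (intro ceiling_unique) auto
    then show ?thesis by simp
  qed
  show ?thesis
  proof (cases "\<nu> = real n")
    case True
    then show ?thesis by (simp add: caputo_derivative_def n frac_integral_def)
  next
    case False
    then have a: "0 < real n - \<nu>" using \<nu> by simp
    have f: "continuous_on {0..t} ?f"
      using x t by (auto elim: continuous_on_subset)
    let ?G = "Gamma (real n - \<nu>)"
    have G: "0 < ?G" using a by (rule Gamma_real_pos)
    have "integrable (lebesgue_on {0..t}) (\<lambda>s. (t - s) powr (real n - \<nu> - 1))"
      using integrable_mult_right[OF integrable_lebesgue_on_kernel[OF a t(1)], of ?G] G by simp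
    then have "banach_bochner_integrable (lebesgue_on {0..t}) (\<lambda>s. (t - s) powr (real n - \<nu> - 1) *\<^sub>R ?f s)"
      using t f by (intro banach_bochner_integrable_scaleR_continuous)
    note B = banach_bochner_integral_eq_integral[OF this]
    have "caputo_derivative T \<nu> x t
        = (1 / ?G) *\<^sub>R integral {0..t} (\<lambda>s. (t - s) powr (real n - \<nu> - 1) *\<^sub>R ?f s)"
      using False by (simp add: caputo_derivative_def n B(1))
    also have "\<dots> = integral {0..t} (\<lambda>s. (1 / ?G) *\<^sub>R ((t - s) powr (real n - \<nu> - 1) *\<^sub>R ?f s))"
      by (rule integral_cmul[symmetric])
    finally show ?thesis using False by (simp add: frac_integral_def)
  qed
qed

text \<open>
  Applying \<open>J\<^sup>\<alpha>\<close> to the equation gives \<open>J\<^sup>2 x'' - A J\<^bsup>\<gamma>+1\<^esup> x' = B J\<^sup>\<alpha> x + J\<^sup>\<alpha> g\<close> with \<open>\<gamma> = \<alpha> - \<beta>\<close>.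
  Here \<open>J\<^sup>2 x'' = z - t \<eta>'\<close>, \<open>J\<^sup>1 x' = z\<close>, and \<open>x = z + \<eta>\<close> on the right.
\<close>

lemma mild_solution_volterra:
  fixes A B :: "'a::banach \<Rightarrow>\<^sub>L 'a"
  assumes T: "0 < T" and \<alpha>: "1 < \<alpha>" "\<alpha> \<le> 2" and \<beta>: "0 < \<beta>" "\<beta> \<le> 1"
    and g: "continuous_on {0..T} g" and sol: "mild_solution T \<alpha> \<beta> A B g \<eta> \<eta>' x"
    and t: "t \<in> {0..T}"
  defines "z \<equiv> \<lambda>t. x t - \<eta>"
  shows "z t = (frac_monomial 1 t *\<^sub>R \<eta>' + frac_monomial \<alpha> t *\<^sub>R B \<eta> + frac_integral \<alpha> g t)
    + (A (frac_integral (\<alpha> - \<beta>) z t) + B (frac_integral \<alpha> z t))"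
proof -
  define w where "w = nth_vector_derivative {0..T} 1 x"
  define y where "y = nth_vector_derivative {0..T} 2 x"
  have C2: "Ck_on 2 {0..T} x" and x0: "x 0 = \<eta>"
    and w0: "w 0 = \<eta>'"
    and eqn: "\<And>t. t \<in> {0<..T} \<Longrightarrow>
      caputo_derivative T \<alpha> x t - A (caputo_derivative T \<beta> x t) = B (x t) + g t"
    using sol by (simp_all add: mild_solution_def w_def nth_vector_derivative_def)
  note C = Ck_on_2D[OF T C2, folded w_def y_def]
  note cont = C(1-3) and x_eq = C(4) and w_eq = C(5)
  note sub = continuous_on_subset[where s = "{0..T}"]
  have J: "continuous_on {0..t} (frac_integral c f)" if "0 \<le> c" "continuous_on {0..T} f" for c f
    using continuous_on_frac_integral[OF that(1) T that(2)] t by (auto elim: sub)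
  have ct: "continuous_on {0..t} x" "continuous_on {0..t} w" "continuous_on {0..t} y" "continuous_on {0..t} g"
    using cont g t by (auto elim: sub)
  have z: "continuous_on {0..T} z"
    unfolding z_def by (intro continuous_intros cont)
  \<comment> \<open>The equation is given for positive times, which suffices under the integral \<open>J\<^sup>\<alpha>\<close>.\<close>
  have "frac_integral (2 - \<alpha>) y s - A (frac_integral (1 - \<beta>) w s) = B (x s) + g s" if "s \<in> {0<..t}" for s
    using eqn[of s] caputo_derivative_eq_frac_integral[of 2 \<alpha> s T x]
      caputo_derivative_eq_frac_integral[of 1 \<beta> s T x] that t \<alpha> \<beta> cont
    by (simp add: w_def y_def)
  then have "frac_integral \<alpha> (\<lambda>s. frac_integral (2 - \<alpha>) y s - A (frac_integral (1 - \<beta>) w s)) t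
      = frac_integral \<alpha> (\<lambda>s. B (x s) + g s) t"
    using \<alpha> t by (intro frac_integral_cong_pos) auto
  moreover have "frac_integral \<alpha> (\<lambda>s. frac_integral (2 - \<alpha>) y s - A (frac_integral (1 - \<beta>) w s)) t
      = frac_integral \<alpha> (frac_integral (2 - \<alpha>) y) t - A (frac_integral \<alpha> (frac_integral (1 - \<beta>) w) t)"
    using \<alpha> \<beta> t cont
    by (simp add: frac_integral_diff frac_integral_blinfun J blinfun.continuous_on)
  moreover have "frac_integral \<alpha> (frac_integral (2 - \<alpha>) y) t = z t - frac_monomial 1 t *\<^sub>R \<eta>'"
  proof -
    have "frac_integral \<alpha> (frac_integral (2 - \<alpha>) y) t = frac_integral 2 y t"
      using frac_integral_frac_integral[of \<alpha> "2 - \<alpha>" T y t] \<alpha> T cont t by simp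
    also have "\<dots> = frac_integral 1 (frac_integral 1 y) t"
      using frac_integral_frac_integral[of 1 1 T y t] T cont t by simp
    also have "\<dots> = frac_integral 1 (\<lambda>s. w s - \<eta>') t"
      using w_eq w0 t by (intro frac_integral_cong) auto
    also have "\<dots> = frac_integral 1 w t - frac_integral 1 (\<lambda>s. frac_monomial 0 s *\<^sub>R \<eta>') t"
      using t ct by (simp add: frac_integral_diff frac_monomial_def)
    also have "\<dots> = z t - frac_monomial 1 t *\<^sub>R \<eta>'"
      using frac_integral_frac_monomial[of 1 0 t \<eta>'] t x_eq[OF t] by (simp add: z_def x0)
    finally show ?thesis .
  qed
  moreover have "frac_integral \<alpha> (frac_integral (1 - \<beta>) w) t = frac_integral (\<alpha> - \<beta>) z t"
  proof -
    have "frac_integral \<alpha> (frac_integral (1 - \<beta>) w) t = frac_integral (\<alpha> - \<beta> + 1) w t"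
      using frac_integral_frac_integral[of \<alpha> "1 - \<beta>" T w t] \<alpha> \<beta> T cont t by (simp add: algebra_simps)
    also have "\<dots> = frac_integral (\<alpha> - \<beta>) (frac_integral 1 w) t"
      using frac_integral_frac_integral[of "\<alpha> - \<beta>" 1 T w t] \<alpha> \<beta> T cont t by simp
    also have "\<dots> = frac_integral (\<alpha> - \<beta>) z t"
      using x_eq t by (intro frac_integral_cong) (auto simp: z_def x0)
    finally show ?thesis .
  qed
  moreover have "frac_integral \<alpha> (\<lambda>s. B (x s) + g s) t
      = (B (frac_integral \<alpha> z t) + frac_monomial \<alpha> t *\<^sub>R B \<eta>) + frac_integral \<alpha> g t"
  proof -
    have "frac_integral \<alpha> z t = frac_integral \<alpha> x t - frac_integral \<alpha> (\<lambda>s. frac_monomial 0 s *\<^sub>R \<eta>) t"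
      unfolding z_def using t ct \<alpha> by (simp add: frac_integral_diff frac_monomial_def)
    then have "frac_integral \<alpha> x t = frac_integral \<alpha> z t + frac_monomial \<alpha> t *\<^sub>R \<eta>"
      using frac_integral_frac_monomial[of \<alpha> 0 t \<eta>] t \<alpha> by simp
    then show ?thesis
      using t ct \<alpha> by (simp add: frac_integral_add frac_integral_blinfun blinfun.continuous_on
          blinfun.add_right blinfun.scaleR_right)
  qed
  ultimately show ?thesis by (simp add: algebra_simps)
qed

text \<open>
  Each of the three parts of the forcing term is a fractional integral or a normalised power, so
  \<open>J\<^bsup>k\<gamma>+m\<alpha>\<^esup>\<close> merely raises its exponent.
\<close>

lemma neumann_term_forcing:
  fixes A B :: "'a::banach \<Rightarrow>\<^sub>L 'a" and g :: "real \<Rightarrow> 'a"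
  assumes \<beta>: "\<beta> < \<alpha>" and \<alpha>: "1 < \<alpha>" and t: "0 < t" and g: "continuous_on {0..t} g"
  shows "neumann_term A B (\<alpha> - \<beta>) \<alpha> n
      (\<lambda>s. frac_monomial 1 s *\<^sub>R \<eta>' + frac_monomial \<alpha> s *\<^sub>R B \<eta> + frac_integral \<alpha> g s) t
    = (\<Sum>k\<le>n. ml_term A B \<alpha> \<beta> 0 1 2 t k (n - k)) \<eta>'
      + (\<Sum>k\<le>n. ml_term A B \<alpha> \<beta> 1 \<alpha> (\<alpha> + 1) t k (n - k)) \<eta>
      + integral {0..t} (\<lambda>s. (\<Sum>k\<le>n. ml_term A B \<alpha> \<beta> 0 (\<alpha> - 1) \<alpha> (t - s) k (n - k)) (g s))"
proof -
  let ?f = "\<lambda>s. frac_monomial 1 s *\<^sub>R \<eta>' + frac_monomial \<alpha> s *\<^sub>R B \<eta> + frac_integral \<alpha> g s"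
  let ?AB = "\<lambda>k m v. blinfun_power A k (blinfun_power B m v)"
  have summand: "real ((k + m) choose m) *\<^sub>R ?AB k m (frac_integral (real k * (\<alpha> - \<beta>) + real m * \<alpha>) ?f t)
      = ml_term A B \<alpha> \<beta> 0 1 2 t k m \<eta>' + ml_term A B \<alpha> \<beta> 1 \<alpha> (\<alpha> + 1) t k m \<eta>
        + integral {0..t} (\<lambda>s. ml_term A B \<alpha> \<beta> 0 (\<alpha> - 1) \<alpha> (t - s) k m (g s))"
    (is "_ = ?rhs")
    and int: "(\<lambda>s. ml_term A B \<alpha> \<beta> 0 (\<alpha> - 1) \<alpha> (t - s) k m (g s)) integrable_on {0..t}" for k m
  proof -
    define e where "e = real k * (\<alpha> - \<beta>) + real m * \<alpha>"
    have e: "0 \<le> e" using \<alpha> \<beta> by (simp add: e_def)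
    have pos: "0 < e + \<alpha>" "0 \<le> e + \<alpha>" "e + \<alpha> \<noteq> 0" using e \<alpha> by auto
    let ?c = "real ((k + m) choose m)"
    have J: "continuous_on {0..t} (frac_integral \<alpha> g)"
      using \<alpha> t g by (intro continuous_on_frac_integral) auto
    have M: "continuous_on {0..t} (\<lambda>s. frac_monomial p s *\<^sub>R v)" if "0 \<le> p" for p and v :: 'a
      using that by (intro continuous_intros continuous_on_frac_monomial)
    have "frac_integral e ?f t = frac_integral e (\<lambda>s. frac_monomial 1 s *\<^sub>R \<eta>') t
        + frac_integral e (\<lambda>s. frac_monomial \<alpha> s *\<^sub>R B \<eta>) t + frac_integral e (frac_integral \<alpha> g) t"
      using e t \<alpha> J M by (simp add: frac_integral_add continuous_on_add)
    also have "\<dots> = frac_monomial (e + 1) t *\<^sub>R \<eta>' + frac_monomial (e + \<alpha>) t *\<^sub>R B \<eta> + frac_integral (e + \<alpha>) g t"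
      using e t \<alpha> g by (simp add: frac_integral_frac_monomial frac_integral_frac_integral[of e \<alpha> t])
    finally have f: "frac_integral e ?f t
      = frac_monomial (e + 1) t *\<^sub>R \<eta>' + frac_monomial (e + \<alpha>) t *\<^sub>R B \<eta> + frac_integral (e + \<alpha>) g t" .
    have BB: "B (blinfun_power B m v) = blinfun_power B m (B v)" for v
      by (rule blinfun_power_commute[symmetric]) simp
    have ml: "ml_term A B \<alpha> \<beta> 0 1 2 t k m v = ?c *\<^sub>R frac_monomial (e + 1) t *\<^sub>R ?AB k m v"
      "ml_term A B \<alpha> \<beta> 1 \<alpha> (\<alpha> + 1) t k m v = ?c *\<^sub>R frac_monomial (e + \<alpha>) t *\<^sub>R ?AB k m (B v)" for v
      using e \<alpha> by (simp_all add: ml_term_eq_frac_monomial e_def[symmetric] blinfun.scaleR_left BB)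
    have mlg: "ml_term A B \<alpha> \<beta> 0 (\<alpha> - 1) \<alpha> (t - s) k m (g s)
        = ?c *\<^sub>R ?AB k m (((t - s) powr (e + \<alpha> - 1) / Gamma (e + \<alpha>)) *\<^sub>R g s)" for s
      using e \<alpha> by (simp add: ml_term_def e_def[symmetric] blinfun.scaleR_left blinfun.scaleR_right add_diff_eq)
    have L: "bounded_linear (\<lambda>v. ?c *\<^sub>R ?AB k m v)"
      by (intro bounded_linear_intros)
    note K = kernel_integrable_on[OF pos(1) less_imp_le[OF t] g]
    show "(\<lambda>s. ml_term A B \<alpha> \<beta> 0 (\<alpha> - 1) \<alpha> (t - s) k m (g s)) integrable_on {0..t}"
      unfolding mlg using integrable_linear[OF K L] by (simp add: o_def)
    have "integral {0..t} (\<lambda>s. ml_term A B \<alpha> \<beta> 0 (\<alpha> - 1) \<alpha> (t - s) k m (g s))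
        = ?c *\<^sub>R ?AB k m (frac_integral (e + \<alpha>) g t)"
      unfolding mlg using integral_linear[OF K L] pos by (simp add: o_def frac_integral_def)
    then show "?c *\<^sub>R ?AB k m (frac_integral (real k * (\<alpha> - \<beta>) + real m * \<alpha>) ?f t) = ?rhs"
      unfolding e_def[symmetric] f ml by (simp add: blinfun.add_right blinfun.scaleR_right scaleR_add_right)
  qed
  have "neumann_term A B (\<alpha> - \<beta>) \<alpha> n ?f t
      = (\<Sum>k\<le>n. real ((k + (n - k)) choose (n - k)) *\<^sub>R
          ?AB k (n - k) (frac_integral (real k * (\<alpha> - \<beta>) + real (n - k) * \<alpha>) ?f t))"
    unfolding neumann_term_def
  proof (rule sum.cong[OF refl])
    fix k assume "k \<in> {..n}"
    then have "n choose k = (k + (n - k)) choose (n - k)"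
      using binomial_symmetric[of k n] by simp
    then show "real (n choose k) *\<^sub>R ?AB k (n - k) (frac_integral (real k * (\<alpha> - \<beta>) + real (n - k) * \<alpha>) ?f t)
        = real ((k + (n - k)) choose (n - k)) *\<^sub>R
          ?AB k (n - k) (frac_integral (real k * (\<alpha> - \<beta>) + real (n - k) * \<alpha>) ?f t)"
      by (simp only:)
  qed
  also have "\<dots> = (\<Sum>k\<le>n. ml_term A B \<alpha> \<beta> 0 1 2 t k (n - k) \<eta>' + ml_term A B \<alpha> \<beta> 1 \<alpha> (\<alpha> + 1) t k (n - k) \<eta>
        + integral {0..t} (\<lambda>s. ml_term A B \<alpha> \<beta> 0 (\<alpha> - 1) \<alpha> (t - s) k (n - k) (g s)))"
    unfolding summand ..
  finally show ?thesis
    using int by (simp add: sum.distrib blinfun.sum_left integral_sum)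
qed

text \<open>
  The Weierstrass M-test makes the operator kernels converge uniformly, which justifies integrating
  the series term by term.
\<close>

lemma blinfun_suminf_kernel_integral:
  fixes D :: "nat \<Rightarrow> real \<Rightarrow> 'a::banach \<Rightarrow>\<^sub>L 'a"
  assumes D: "\<And>n. continuous_on {0..t} (D n)" and g: "continuous_on {0..t} g"
    and le: "\<And>n s. s \<in> {0..t} \<Longrightarrow> norm (D n s) \<le> M n" and M: "summable M"
  shows "continuous_on {0..t} (\<lambda>s. (\<Sum>n. D n s) (g s))"
    and "(\<lambda>n. integral {0..t} (\<lambda>s. D n s (g s))) sums integral {0..t} (\<lambda>s. (\<Sum>n. D n s) (g s))"
proof -
  have lim: "uniform_limit {0..t} (\<lambda>N s. \<Sum>n<N. D n s) (\<lambda>s. \<Sum>n. D n s) sequentially"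
    using le M by (rule Weierstrass_m_test)
  have DN: "continuous_on {0..t} (\<lambda>s. \<Sum>n<N. D n s)" for N
    by (intro continuous_on_sum D)
  have S: "continuous_on {0..t} (\<lambda>s. \<Sum>n. D n s)"
    by (rule uniform_limit_theorem[OF _ lim]) (simp_all add: DN)
  show "continuous_on {0..t} (\<lambda>s. (\<Sum>n. D n s) (g s))"
    by (intro blinfun.continuous_on S g)
  have "bounded ((\<lambda>s. \<Sum>n. D n s) ` {0..t})" "bounded (g ` {0..t})"
    by (intro compact_imp_bounded compact_continuous_image S g compact_Icc)+
  then have "uniform_limit {0..t} (\<lambda>N s. (\<Sum>n<N. D n s) (g s)) (\<lambda>s. (\<Sum>n. D n s) (g s)) sequentially"
    by (intro bounded_bilinear.bounded_uniform_limit[OF bounded_bilinear_blinfun_apply lim uniform_limit_const])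
  from uniform_limit_integral_cbox[where a = 0 and b = t, unfolded box_real, OF this blinfun.continuous_on[OF DN g]]
  obtain I J where IJ: "\<And>N. ((\<lambda>s. (\<Sum>n<N. D n s) (g s)) has_integral I N) {0..t}"
    "((\<lambda>s. (\<Sum>n. D n s) (g s)) has_integral J) {0..t}" "I \<longlonglongrightarrow> J"
    by auto
  have "(\<lambda>s. D n s (g s)) integrable_on {0..t}" for n
    by (intro integrable_continuous_real blinfun.continuous_on D g)
  then have "I N = (\<Sum>n<N. integral {0..t} (\<lambda>s. D n s (g s)))" for N
    using integral_unique[OF IJ(1)[of N]] by (simp add: blinfun.sum_left integral_sum)
  then have "I = (\<lambda>N. \<Sum>n<N. integral {0..t} (\<lambda>s. D n s (g s)))" by blast
  then show "(\<lambda>n. integral {0..t} (\<lambda>s. D n s (g s))) sums integral {0..t} (\<lambda>s. (\<Sum>n. D n s) (g s))"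
    using IJ(3) integral_unique[OF IJ(2)] by (simp add: sums_def)
qed

theorem theorem4p3:
  fixes A B :: "'a::banach \<Rightarrow>\<^sub>L 'a"
    and \<alpha> \<beta> T t :: real
    and \<eta> \<eta>' :: 'a
    and g x :: "real \<Rightarrow> 'a"
  assumes "0 < T"
    and "(A o\<^sub>L B) - (B o\<^sub>L A) = 0"
    and "1 < \<alpha>" and "\<alpha> \<le> 2"
    and "0 < \<beta>" and "\<beta> \<le> 1"
    and "continuous_on {0..T} g"
    and "mild_solution T \<alpha> \<beta> A B g \<eta> \<eta>' x"
    and "0 < t" and "t \<le> T"
  shows "iterated_summable (ml_term A B \<alpha> \<beta> 1 \<alpha> (\<alpha> + 1) t)
    \<and> iterated_summable (ml_term A B \<alpha> \<beta> 0 1 2 t)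
    \<and> (\<forall>s\<in>{0..t}. iterated_summable (ml_term A B \<alpha> \<beta> 0 (\<alpha> - 1) \<alpha> (t - s)))
    \<and> banach_bochner_integrable (lebesgue_on {0..t})
        (\<lambda>s. (\<Sum>k. \<Sum>m. ml_term A B \<alpha> \<beta> 0 (\<alpha> - 1) \<alpha> (t - s) k m) (g s))
    \<and> x t =
        (id_blinfun + (\<Sum>k. \<Sum>m. ml_term A B \<alpha> \<beta> 1 \<alpha> (\<alpha> + 1) t k m)) \<eta>
        + (\<Sum>k. \<Sum>m. ml_term A B \<alpha> \<beta> 0 1 2 t k m) \<eta>'
        + banach_bochner_integral (lebesgue_on {0..t})
            (\<lambda>s. (\<Sum>k. \<Sum>m. ml_term A B \<alpha> \<beta> 0 (\<alpha> - 1) \<alpha> (t - s) k m) (g s))"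
proof -
  note T = assms(1) and \<alpha> = assms(3,4) and \<beta> = assms(5,6) and g = assms(7) and sol = assms(8) and t = assms(9,10)
  have AB: "A (B v) = B (A v)" for v
    using arg_cong[OF assms(2), of "\<lambda>F. F v"] by (simp add: blinfun.diff_left)
  have \<gamma>: "0 < \<alpha> - \<beta>" "\<alpha> - \<beta> \<le> \<alpha>" using \<alpha> \<beta> by auto
  have gt: "continuous_on {0..t} g" using t by (auto intro: continuous_on_subset[OF g])
  have series: "iterated_summable (ml_term A B \<alpha> \<beta> j p q t)"
    "(\<lambda>n. \<Sum>k\<le>n. ml_term A B \<alpha> \<beta> j p q t k (n - k)) sums (\<Sum>k. \<Sum>m. ml_term A B \<alpha> \<beta> j p q t k m)"
    if p: "0 < p" "q = p + 1" for j p q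
  proof -
    obtain C a b where C: "0 \<le> C" "0 \<le> a" "0 \<le> b" "a + b < 1"
      and le: "\<And>k m s. 0 \<le> s \<Longrightarrow> s \<le> t \<Longrightarrow>
        norm (ml_term A B \<alpha> \<beta> j p q s k m) \<le> C * (real ((k + m) choose m) * (a ^ k * b ^ m))"
      by (rule ml_term_binomial_majorant[of \<beta> \<alpha> t p q A B j]) (use \<alpha> \<beta> t p in auto)
    show "iterated_summable (ml_term A B \<alpha> \<beta> j p q t)"
      "(\<lambda>n. \<Sum>k\<le>n. ml_term A B \<alpha> \<beta> j p q t k (n - k)) sums (\<Sum>k. \<Sum>m. ml_term A B \<alpha> \<beta> j p q t k m)"
      using double_series_binomial_majorant(1,2)[OF C le[of t]] t by auto
  qed
  let ?ml = "\<lambda>s. ml_term A B \<alpha> \<beta> 0 (\<alpha> - 1) \<alpha> (t - s)"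
  let ?K = "\<lambda>s. \<Sum>k. \<Sum>m. ?ml s k m"
  let ?D = "\<lambda>n s. \<Sum>k\<le>n. ?ml s k (n - k)"
  obtain C a b where C: "0 \<le> C" "0 \<le> a" "0 \<le> b" "a + b < 1"
    and le: "\<And>k m s. 0 \<le> s \<Longrightarrow> s \<le> t \<Longrightarrow>
      norm (ml_term A B \<alpha> \<beta> 0 (\<alpha> - 1) \<alpha> s k m) \<le> C * (real ((k + m) choose m) * (a ^ k * b ^ m))"
    by (rule ml_term_binomial_majorant[of \<beta> \<alpha> t "\<alpha> - 1" \<alpha> A B 0]) (use \<alpha> \<beta> t in auto)
  have kernel: "iterated_summable (?ml s)" "(\<lambda>n. ?D n s) sums ?K s" "norm (?D n s) \<le> C * (a + b) ^ n"
    if "s \<in> {0..t}" for s n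
    using double_series_binomial_majorant[OF C le[of "t - s"]] that by auto
  have D: "continuous_on {0..t} (?D n)" for n
  proof (intro continuous_on_sum)
    fix k
    let ?e = "real k * (\<alpha> - \<beta>) + real (n - k) * \<alpha> + (\<alpha> - 1)"
    have e: "0 < ?e" using \<alpha> \<gamma> by (intro add_nonneg_pos add_nonneg_nonneg) auto
    have "continuous_on {0..t} (\<lambda>s. frac_monomial ?e (t - s))"
      by (rule continuous_on_compose2[OF continuous_on_frac_monomial[of ?e t]])
        (use e in \<open>auto intro!: continuous_intros\<close>)
    then show "continuous_on {0..t} (\<lambda>s. ?ml s k (n - k))"
      by (subst ml_term_eq_frac_monomial[OF e]) (auto intro!: continuous_intros)
  qed
  have M: "summable (\<lambda>n. C * (a + b) ^ n)"
    using C by (intro summable_mult summable_geometric) auto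
  have K_eq: "(\<Sum>n. ?D n s) = ?K s" if "s \<in> {0..t}" for s
    using kernel(2)[OF that] by (simp add: sums_iff)
  have K_g: "(\<Sum>n. ?D n s) (g s) = ?K s (g s)" if "s \<in> {0..t}" for s
    unfolding K_eq[OF that] ..
  have Kint: "continuous_on {0..t} (\<lambda>s. (\<Sum>n. ?D n s) (g s))"
    "(\<lambda>n. integral {0..t} (\<lambda>s. ?D n s (g s))) sums integral {0..t} (\<lambda>s. (\<Sum>n. ?D n s) (g s))"
    by (rule blinfun_suminf_kernel_integral[OF D gt kernel(3) M], assumption)+
  have K_cont: "continuous_on {0..t} (\<lambda>s. ?K s (g s))"
    by (rule continuous_on_eq[OF Kint(1)]) (rule K_g)
  have K_sums: "(\<lambda>n. integral {0..t} (\<lambda>s. ?D n s (g s))) sums integral {0..t} (\<lambda>s. ?K s (g s))"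
  proof -
    have "integral {0..t} (\<lambda>s. (\<Sum>n. ?D n s) (g s)) = integral {0..t} (\<lambda>s. ?K s (g s))"
      by (rule integral_cong) (rule K_g)
    with Kint(2) show ?thesis by (simp only:)
  qed
  have bochner: "banach_bochner_integrable (lebesgue_on {0..t}) (\<lambda>s. ?K s (g s))"
    using banach_bochner_integrable_scaleR_continuous[of 0 t "\<lambda>_. 1" "\<lambda>s. ?K s (g s)"] K_cont t
    by (simp add: continuous_imp_integrable_real)
  let ?f = "\<lambda>s. frac_monomial 1 s *\<^sub>R \<eta>' + frac_monomial \<alpha> s *\<^sub>R B \<eta> + frac_integral \<alpha> g s"
  let ?S0 = "\<Sum>k. \<Sum>m. ml_term A B \<alpha> \<beta> 0 1 2 t k m"
  let ?S1 = "\<Sum>k. \<Sum>m. ml_term A B \<alpha> \<beta> 1 \<alpha> (\<alpha> + 1) t k m"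
  have x: "continuous_on {0..T} x"
    using sol Ck_on_2D(1)[OF T] by (auto simp: mild_solution_def)
  have "(\<lambda>n. neumann_term A B (\<alpha> - \<beta>) \<alpha> n ?f t) sums (x t - \<eta>)"
  proof (rule volterra_neumann_series[OF AB \<gamma> T _ _ _ t])
    show "continuous_on {0..T} (\<lambda>t. x t - \<eta>)" by (intro continuous_intros x)
    show "continuous_on {0..T} ?f"
      using \<alpha> T g by (intro continuous_intros continuous_on_frac_monomial continuous_on_frac_integral) auto
  qed (rule mild_solution_volterra[OF T \<alpha> \<beta> g sol])
  moreover have "(\<lambda>n. neumann_term A B (\<alpha> - \<beta>) \<alpha> n ?f t)
      sums (?S0 \<eta>' + ?S1 \<eta> + integral {0..t} (\<lambda>s. ?K s (g s)))"
  proof (subst neumann_term_forcing)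
    show "(\<lambda>n. (\<Sum>k\<le>n. ml_term A B \<alpha> \<beta> 0 1 2 t k (n - k)) \<eta>'
        + (\<Sum>k\<le>n. ml_term A B \<alpha> \<beta> 1 \<alpha> (\<alpha> + 1) t k (n - k)) \<eta>
        + integral {0..t} (\<lambda>s. ?D n s (g s))) sums (?S0 \<eta>' + ?S1 \<eta> + integral {0..t} (\<lambda>s. ?K s (g s)))"
      using \<alpha> by (intro sums_add K_sums bounded_linear.sums[OF blinfun.bounded_linear_left] series(2)) auto
  qed (use \<gamma> \<alpha> t gt in auto)
  ultimately have "x t - \<eta> = ?S0 \<eta>' + ?S1 \<eta> + integral {0..t} (\<lambda>s. ?K s (g s))"
    by (rule sums_unique2)
  then have "x t = (id_blinfun + ?S1) \<eta> + ?S0 \<eta>'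
      + banach_bochner_integral (lebesgue_on {0..t}) (\<lambda>s. ?K s (g s))"
    by (simp add: banach_bochner_integral_eq_integral(1)[OF bochner] blinfun.add_left algebra_simps)
  then show ?thesis
    using series(1)[of \<alpha> "\<alpha> + 1" 1] series(1)[of 1 2 0] kernel(1) bochner \<alpha> by auto
qed

end
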